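(* Let $F$ and $E$ be lcHs over $\mathbb{K}$, $(f_{n})_{n\in\mathbb{N}}$ an equicontinuous Schauder basis of $F$ with associated coefficient functionals $(\lambda_{n})_{n\in\mathbb{N}}$ and set $Q_{n}\colon F\to F$, $Q_{n}(f):=\lambda_{n}(f)f_{n}$, for every $n\in\mathbb{N}$. Then the following holds: a) The sequence $(P_{k})_{k\in\mathbb{N}}$ given by $P_{k}:=\bigl(\sum_{n=1}^{k}Q_{n}\bigr)\varepsilon\operatorname{id}_{E}$ is a Schauder decomposition of $F\varepsilon E$. b) Each $u\in F\varepsilon E$ has the series representation \[ u(f')=\sum_{n=1}^{\infty}u(\lambda_{n})f'(f_{n}),\quad f'\in F'. \] c) $F\otimes E$ is sequentially dense in $F\varepsilon E$.
   Context: $\mathbb{K}=\mathbb{R}$ or $\mathbb{C}$. An lcHs is a non-trivial ($\neq\{0\}$) locally convex Hausdorff space over $\mathbb{K}$. $F'_{\kappa}$ is $F'$ with the topology of uniform convergence on absolutely convex compact subsets of $F$; $F\varepsilon E:=L_{e}(F'_{\kappa},E)$ is the space of continuous linear maps $F'_\kappa\to E$ with the topology of uniform convergence on equicontinuous subsets of $F'$. For $T\in L(F,F)$, $(T\varepsilon\operatorname{id}_E)(u):=u\circ T^{t}$, $u\in F\varepsilon E$, with $T^{t}(f')=f'\circ T$. $F\otimes E$ is regarded as a linear subspace of $F\varepsilon E$ via $\sum_{n}f_n\otimes e_n\mapsto[y\mapsto\sum_n y(f_n)e_n]$. $(f_n)$ is a Schauder basis of $F$ if every $f\in F$ has a unique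 expansion $f=\sum_{n=1}^{\infty}\lambda_n(f)f_n$ converging in $F$ with $\lambda_n(f)\in\mathbb{K}$, and the (linear) coefficient functionals $\lambda_n$ are continuous; it is equicontinuous if the expansion operators $f\mapsto\sum_{n=1}^{k}\lambda_n(f)f_n$, $k\in\mathbb{N}$, form an equicontinuous sequence in $L(F,F)$. A Schauder decomposition of an lcHs $X$ is a sequence $(P_k)_{k\in\mathbb{N}}$ of continuous linear projections on $X$ such that $P_kP_j=P_{\min(j,k)}$ for all $j,k$, $P_k\neq P_j$ for $k\neq j$, and $P_kx\to x$ for each $x\in X$. *)

theory Defs
  imports "HOL-Analysis.Analysis" "HOL-Library.Function_Algebras"
begin

text \<open>
  The scalar field. Up to isometric isomorphism the only instances are the real and the complex
  numbers: the multiplicative norm forces the norm of \<open>a + b i\<close> to be the usual modulus.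
\<close>

class real_or_complex = real_normed_field + heine_borel +
  assumes real_or_complex:
    "(\<forall>z. \<exists>a. z = a *\<^sub>R 1) \<or>
     (\<exists>i. i * i = - 1 \<and> (\<forall>z. \<exists>a b. z = a *\<^sub>R 1 + b *\<^sub>R i))"

instance real :: real_or_complex
  by standard auto

instance complex :: real_or_complex
proof
  have "\<exists>a b. z = a *\<^sub>R 1 + b *\<^sub>R \<i>" for z :: complex
    by (intro exI[of _ "Re z"] exI[of _ "Im z"]) (simp add: complex_eq_iff)
  then have "\<i> * \<i> = - 1 \<and> (\<forall>z. \<exists>a b. z = a *\<^sub>R 1 + b *\<^sub>R \<i>)"
    by simp
  then show "(\<forall>z::complex. \<exists>a. z = a *\<^sub>R 1) \<or>
      (\<exists>i::complex. i * i = - 1 \<and> (\<forall>z. \<exists>a b. z = a *\<^sub>R 1 + b *\<^sub>R i))"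
    by blast
qed

text \<open>
  Spaces of linear maps have to be lcHs as well, so a space is given by a scalar multiplication
  on a type together with a topology whose \<^const>\<open>topspace\<close>, the carrier, is a linear subspace.
\<close>

locale lcHs = vector_space scale
  for scale :: "'k::real_or_complex \<Rightarrow> 'a::ab_group_add \<Rightarrow> 'a" +
  fixes X :: "'a topology"
  assumes subspace_topspace: "subspace (topspace X)"
    and nontrivial: "topspace X \<noteq> {0}"
    and Hausdorff: "Hausdorff_space X"
    and continuous_add: "continuous_map (prod_topology X X) X (\<lambda>(x, y). x + y)"
    and continuous_scale: "continuous_map (prod_topology euclidean X) X (\<lambda>(c, x). scale c x)"
    and locally_convex:
      "openin X U \<Longrightarrow> 0 \<in> U \<Longrightarrow>
        \<exists>C V. openin X V \<and> 0 \<in> V \<and> V \<subseteq> C \<and> C \<subseteq> U \<and>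
          (\<forall>x\<in>C. \<forall>y\<in>C. \<forall>t\<in>{0..1}. scale (of_real t) x + scale (of_real (1 - t)) y \<in> C)"

definition continuous_linear ::
  "('k \<Rightarrow> 'a::ab_group_add \<Rightarrow> 'a) \<Rightarrow> 'a topology \<Rightarrow> ('k \<Rightarrow> 'b::ab_group_add \<Rightarrow> 'b) \<Rightarrow> 'b topology \<Rightarrow>
   ('a \<Rightarrow> 'b) \<Rightarrow> bool" where
  "continuous_linear s X t Y u \<longleftrightarrow>
     (\<forall>x\<in>topspace X. \<forall>y\<in>topspace X. u (x + y) = u x + u y) \<and>
     (\<forall>c. \<forall>x\<in>topspace X. u (s c x) = t c (u x)) \<and>
     continuous_map X Y u"

text \<open>
  The space \<open>L(X, Y)\<close>. A map on the carrier of \<open>X\<close> is represented by its extension by zero, so that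
  equality of representatives is equality on the carrier.
\<close>

definition linear_maps ::
  "('k \<Rightarrow> 'a::ab_group_add \<Rightarrow> 'a) \<Rightarrow> 'a topology \<Rightarrow> ('k \<Rightarrow> 'b::ab_group_add \<Rightarrow> 'b) \<Rightarrow> 'b topology \<Rightarrow>
   ('a \<Rightarrow> 'b) set" where
  "linear_maps s X t Y = {u. continuous_linear s X t Y u \<and> (\<forall>x. x \<notin> topspace X \<longrightarrow> u x = 0)}"

definition dual :: "('k::real_or_complex \<Rightarrow> 'a::ab_group_add \<Rightarrow> 'a) \<Rightarrow> 'a topology \<Rightarrow> ('a \<Rightarrow> 'k) set"
  where "dual s X = linear_maps s X (*) euclidean"

definition equicontinuous ::
  "'a topology \<Rightarrow> 'b::ab_group_add topology \<Rightarrow> ('a \<Rightarrow> 'b) set \<Rightarrow> bool" where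
  "equicontinuous X Y H \<longleftrightarrow>
     (\<forall>x\<in>topspace X. \<forall>V. openin Y V \<and> 0 \<in> V \<longrightarrow>
        (\<exists>U. openin X U \<and> x \<in> U \<and> (\<forall>h\<in>H. \<forall>z\<in>U. h z - h x \<in> V)))"

definition absolutely_convex ::
  "('k::real_or_complex \<Rightarrow> 'a::ab_group_add \<Rightarrow> 'a) \<Rightarrow> 'a set \<Rightarrow> bool" where
  "absolutely_convex s A \<longleftrightarrow>
     (\<forall>x\<in>A. \<forall>y\<in>A. \<forall>a b. norm a + norm b \<le> 1 \<longrightarrow> s a x + s b y \<in> A)"

text \<open>
  The topology on the set \<open>M\<close> of maps into \<open>Y\<close> of uniform convergence on the members of \<open>S\<close>.
  Finite subfamilies are used because \<open>S\<close> need not be directed.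
\<close>

definition uniform_convergence_topology ::
  "'i set set \<Rightarrow> 'b::ab_group_add topology \<Rightarrow> ('i \<Rightarrow> 'b) set \<Rightarrow> ('i \<Rightarrow> 'b) topology" where
  "uniform_convergence_topology S Y M = topology (\<lambda>W. W \<subseteq> M \<and>
     (\<forall>u\<in>W. \<exists>\<A> V. finite \<A> \<and> \<A> \<subseteq> S \<and> openin Y V \<and> 0 \<in> V \<and>
        {v\<in>M. \<forall>i\<in>\<Union>\<A>. v i - u i \<in> V} \<subseteq> W))"

lemma openin_uniform_convergence_topology:
  "openin (uniform_convergence_topology S Y M) W \<longleftrightarrow> W \<subseteq> M \<and>
     (\<forall>u\<in>W. \<exists>\<A> V. finite \<A> \<and> \<A> \<subseteq> S \<and> openin Y V \<and> 0 \<in> V \<and>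
        {v\<in>M. \<forall>i\<in>\<Union>\<A>. v i - u i \<in> V} \<subseteq> W)"
proof -
  define N where "N \<A> V u = {v\<in>M. \<forall>i\<in>\<Union>\<A>. v i - u i \<in> V}" for \<A> V u
  define basic where "basic \<A> V \<longleftrightarrow> finite \<A> \<and> \<A> \<subseteq> S \<and> openin Y V \<and> 0 \<in> V" for \<A> V
  define nbhd where "nbhd W u \<longleftrightarrow> (\<exists>\<A> V. basic \<A> V \<and> N \<A> V u \<subseteq> W)" for W u
  have basic_Int: "basic (\<A>1 \<union> \<A>2) (V1 \<inter> V2)" if "basic \<A>1 V1" "basic \<A>2 V2" for \<A>1 \<A>2 V1 V2
    using that by (simp add: basic_def openin_Int)
  have N_Int: "N (\<A>1 \<union> \<A>2) (V1 \<inter> V2) u \<subseteq> N \<A>1 V1 u \<inter> N \<A>2 V2 u" for \<A>1 \<A>2 V1 V2 u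
    by (auto simp: N_def)
  have nbhd_Int: "nbhd (W1 \<inter> W2) u" if "nbhd W1 u" "nbhd W2 u" for W1 W2 u
    using that basic_Int N_Int unfolding nbhd_def
    by (metis Int_mono subset_trans)
  have nbhd_mono: "nbhd W' u" if "nbhd W u" "W \<subseteq> W'" for W W' u
    using that unfolding nbhd_def by (metis subset_trans)
  have "istopology (\<lambda>W. W \<subseteq> M \<and> (\<forall>u\<in>W. nbhd W u))"
    unfolding istopology_def by (auto intro: nbhd_Int nbhd_mono[OF _ Union_upper])
  then show ?thesis
    unfolding uniform_convergence_topology_def nbhd_def basic_def N_def
    by (simp add: topology_inverse' conj_assoc)
qed

lemma topspace_uniform_convergence_topology:
  assumes "0 \<in> topspace Y"
  shows "topspace (uniform_convergence_topology S Y M) = M"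
proof
  show "topspace (uniform_convergence_topology S Y M) \<subseteq> M"
    using openin_topspace[of "uniform_convergence_topology S Y M"]
    unfolding openin_uniform_convergence_topology by blast
  have "openin (uniform_convergence_topology S Y M) M"
    unfolding openin_uniform_convergence_topology
    using assms by (auto intro!: exI[of _ "{}"] exI[of _ "topspace Y"])
  then show "M \<subseteq> topspace (uniform_convergence_topology S Y M)"
    by (rule openin_subset)
qed

definition dual_kappa ::
  "('k::real_or_complex \<Rightarrow> 'a::ab_group_add \<Rightarrow> 'a) \<Rightarrow> 'a topology \<Rightarrow> ('a \<Rightarrow> 'k) topology" where
  "dual_kappa s F =
     uniform_convergence_topology {A. compactin F A \<and> absolutely_convex s A} euclidean (dual s F)"

definition eps_product ::
  "('k::real_or_complex \<Rightarrow> 'a::ab_group_add \<Rightarrow> 'a) \<Rightarrow> 'a topology \<Rightarrow>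
   ('k \<Rightarrow> 'b::ab_group_add \<Rightarrow> 'b) \<Rightarrow> 'b topology \<Rightarrow> (('a \<Rightarrow> 'k) \<Rightarrow> 'b) topology" where
  "eps_product s F t E =
     uniform_convergence_topology {H. H \<subseteq> dual s F \<and> equicontinuous F euclidean H} E
       (linear_maps (\<lambda>c y x. c * y x) (dual_kappa s F) t E)"

definition eps_scale :: "('k \<Rightarrow> 'b \<Rightarrow> 'b) \<Rightarrow> 'k \<Rightarrow> (('a \<Rightarrow> 'k) \<Rightarrow> 'b) \<Rightarrow> (('a \<Rightarrow> 'k) \<Rightarrow> 'b)" where
  "eps_scale t c u = (\<lambda>y. t c (u y))"

text \<open>
  The value 0 off the dual makes \<open>u \<circ> transposed s F T\<close> vanish there, as
  \<^const>\<open>linear_maps\<close> requires; \<open>y \<circ> T\<close> itself can lie in the dual although \<open>y\<close> does not.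
\<close>

definition transposed ::
  "('k::real_or_complex \<Rightarrow> 'a::ab_group_add \<Rightarrow> 'a) \<Rightarrow> 'a topology \<Rightarrow> ('a \<Rightarrow> 'a) \<Rightarrow>
   ('a \<Rightarrow> 'k) \<Rightarrow> ('a \<Rightarrow> 'k)" where
  "transposed s F T y = (if y \<in> dual s F then y \<circ> T else 0)"

definition eps_id ::
  "('k::real_or_complex \<Rightarrow> 'a::ab_group_add \<Rightarrow> 'a) \<Rightarrow> 'a topology \<Rightarrow> ('a \<Rightarrow> 'a) \<Rightarrow>
   (('a \<Rightarrow> 'k) \<Rightarrow> 'b) \<Rightarrow> (('a \<Rightarrow> 'k) \<Rightarrow> 'b)" where
  "eps_id s F T u = u \<circ> transposed s F T"

text \<open>The tensor product as a subspace of the \<open>\<epsilon>\<close>-product: the image of the canonical map.\<close>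

definition tensor_product ::
  "('k::real_or_complex \<Rightarrow> 'a::ab_group_add \<Rightarrow> 'a) \<Rightarrow> 'a topology \<Rightarrow>
   ('k \<Rightarrow> 'b::ab_group_add \<Rightarrow> 'b) \<Rightarrow> 'b topology \<Rightarrow> (('a \<Rightarrow> 'k) \<Rightarrow> 'b) set" where
  "tensor_product s F t E =
     {\<lambda>y. if y \<in> dual s F then \<Sum>n<N. t (y (g n)) (e n) else 0 | (N::nat) g e.
        (\<forall>n<N. g n \<in> topspace F \<and> e n \<in> topspace E)}"

text \<open>
  Sequences are indexed from 0: the terms with index \<open>n \<ge> 1\<close> in the usual notation are those with
  index \<open>n - 1\<close> here, so that the first \<open>k + 1\<close> terms make up the partial sum with index \<open>k\<close>.
\<close>

definition schauder_basis ::
  "('k::real_or_complex \<Rightarrow> 'a::ab_group_add \<Rightarrow> 'a) \<Rightarrow> 'a topology \<Rightarrow> (nat \<Rightarrow> 'a) \<Rightarrow>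
   (nat \<Rightarrow> 'a \<Rightarrow> 'k) \<Rightarrow> bool" where
  "schauder_basis s F f l \<longleftrightarrow>
     (\<forall>n. f n \<in> topspace F) \<and> (\<forall>n. l n \<in> dual s F) \<and>
     (\<forall>x\<in>topspace F.
        limitin F (\<lambda>k. \<Sum>n\<le>k. s (l n x) (f n)) x sequentially \<and>
        (\<forall>c. limitin F (\<lambda>k. \<Sum>n\<le>k. s (c n) (f n)) x sequentially \<longrightarrow> (\<forall>n. c n = l n x)))"

definition equicontinuous_schauder_basis ::
  "('k::real_or_complex \<Rightarrow> 'a::ab_group_add \<Rightarrow> 'a) \<Rightarrow> 'a topology \<Rightarrow> (nat \<Rightarrow> 'a) \<Rightarrow>
   (nat \<Rightarrow> 'a \<Rightarrow> 'k) \<Rightarrow> bool" where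
  "equicontinuous_schauder_basis s F f l \<longleftrightarrow>
     schauder_basis s F f l \<and> equicontinuous F F (range (\<lambda>k x. \<Sum>n\<le>k. s (l n x) (f n)))"

definition schauder_decomposition ::
  "('k::real_or_complex \<Rightarrow> 'a::ab_group_add \<Rightarrow> 'a) \<Rightarrow> 'a topology \<Rightarrow> (nat \<Rightarrow> 'a \<Rightarrow> 'a) \<Rightarrow> bool" where
  "schauder_decomposition s X P \<longleftrightarrow>
     lcHs s X \<and>
     (\<forall>k. continuous_linear s X s X (P k) \<and> (\<forall>x\<in>topspace X. P k (P k x) = P k x)) \<and>
     (\<forall>k j. \<forall>x\<in>topspace X. P k (P j x) = P (min j k) x) \<and>
     (\<forall>k j. k \<noteq> j \<longrightarrow> (\<exists>x\<in>topspace X. P k x \<noteq> P j x)) \<and>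
     (\<forall>x\<in>topspace X. limitin X (\<lambda>k. P k x) x sequentially)"

definition sequentially_dense :: "'a topology \<Rightarrow> 'a set \<Rightarrow> bool" where
  "sequentially_dense X A \<longleftrightarrow>
     A \<subseteq> topspace X \<and> (\<forall>x\<in>topspace X. \<exists>a. (\<forall>k. a k \<in> A) \<and> limitin X a x sequentially)"

end

theory Submission
  imports Defs
begin

text \<open>
  Write \<open>T\<^sub>k\<close> for the expansion operators of the basis. Equicontinuity upgrades the pointwise
  convergence \<open>T\<^sub>k \<rightarrow> id\<close> to uniform convergence on compact sets. If \<open>H \<subseteq> F'\<close> is equicontinuous, then
  \<open>y \<circ> T\<^sub>k - y\<close> becomes small on every compact set, uniformly for \<open>y \<in> H\<close>; as \<open>u \<in> F \<epsilon> E\<close> is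
  continuous for the topology of uniform convergence on (absolutely convex) compact sets,
  \<open>u (y \<circ> T\<^sub>k) \<rightarrow> u y\<close> uniformly on \<open>H\<close>, that is, \<open>P\<^sub>k u \<rightarrow> u\<close>. Since
  \<open>y \<circ> T\<^sub>k = \<Sum>\<^sub>n\<^sub>\<le>\<^sub>k y (f\<^sub>n) \<lambda>\<^sub>n\<close>, the map \<open>P\<^sub>k u\<close> is the tensor \<open>\<Sum>\<^sub>n\<^sub>\<le>\<^sub>k f\<^sub>n \<otimes> u (\<lambda>\<^sub>n)\<close>, and the remaining
  claims follow from \<open>\<lambda>\<^sub>n (f\<^sub>m) = \<delta>\<^sub>n\<^sub>m\<close>.
\<close>

section \<open>Finite sums of functions and eventual statements on compact sets\<close>

lemma sum_fun_apply: "(\<Sum>i\<in>A. g i) x = (\<Sum>i\<in>A. g i x)" for g :: "'i \<Rightarrow> 'a \<Rightarrow> 'b::comm_monoid_add"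
  by (induction A rule: infinite_finite_induct) auto

text \<open>A finite subcover reduces the claim to an intersection of finitely many eventual events.
  It serves two filters: \<open>nhds 0\<close> on the scalars, to shrink a compact set into a
  neighbourhood of 0, and \<open>sequentially\<close>, for uniform convergence of operators on
  compact sets.\<close>

lemma compactin_eventually_ball:
  assumes "compactin X K"
    and "\<And>x. x \<in> K \<Longrightarrow> \<exists>U. openin X U \<and> x \<in> U \<and> (\<forall>\<^sub>F n in G. \<forall>z\<in>U. R n z)"
  shows "\<forall>\<^sub>F n in G. \<forall>z\<in>K. R n z"
proof -
  define \<U> where "\<U> = {U. openin X U \<and> (\<forall>\<^sub>F n in G. \<forall>z\<in>U. R n z)}"
  have "K \<subseteq> \<Union>\<U>"
    using assms(2) by (force simp: \<U>_def)
  then obtain \<F> where \<F>: "finite \<F>" "\<F> \<subseteq> \<U>" "K \<subseteq> \<Union>\<F>"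
    using assms(1) unfolding compactin_def \<U>_def by (metis (no_types, lifting) mem_Collect_eq)
  have "\<forall>\<^sub>F n in G. \<forall>U\<in>\<F>. \<forall>z\<in>U. R n z"
    using \<F>(1,2) by (intro eventually_ball_finite) (auto simp: \<U>_def)
  then show ?thesis
    by (rule eventually_mono) (use \<F>(3) in blast)
qed

section \<open>Neighbourhood calculus in a single lcHs\<close>

context lcHs
begin

lemma zero_in [simp, intro]: "0 \<in> topspace X"
  using subspace_topspace by (rule subspace_0)

lemma add_in [simp, intro]: "x \<in> topspace X \<Longrightarrow> y \<in> topspace X \<Longrightarrow> x + y \<in> topspace X"
  using subspace_topspace by (rule subspace_add)

lemma diff_in [simp, intro]: "x \<in> topspace X \<Longrightarrow> y \<in> topspace X \<Longrightarrow> x - y \<in> topspace X"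
  using subspace_topspace by (rule subspace_diff)

lemma scale_in [simp, intro]: "x \<in> topspace X \<Longrightarrow> scale c x \<in> topspace X"
  using subspace_topspace by (rule subspace_scale)

lemma continuous_map_add:
  assumes "continuous_map T X g" "continuous_map T X h"
  shows "continuous_map T X (\<lambda>x. g x + h x)"
  using continuous_map_compose[OF continuous_map_pairedI[OF assms] continuous_add]
  by (simp add: o_def)

lemma continuous_map_scale:
  assumes "continuous_map T euclidean c" "continuous_map T X g"
  shows "continuous_map T X (\<lambda>x. scale (c x) (g x))"
  using continuous_map_compose[OF continuous_map_pairedI[OF assms] continuous_scale]
  by (simp add: o_def)

lemma continuous_map_diff:
  assumes "continuous_map T X g" "continuous_map T X h"
  shows "continuous_map T X (\<lambda>x. g x - h x)"
proof -
  have "continuous_map T X (\<lambda>x. g x + scale (- 1) (h x))"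
    by (intro continuous_map_add continuous_map_scale assms) simp
  then show ?thesis
    by simp
qed

lemma continuous_map_sum:
  assumes "\<And>i. i \<in> A \<Longrightarrow> continuous_map T X (g i)"
  shows "continuous_map T X (\<lambda>x. \<Sum>i\<in>A. g i x)"
  using assms by (induction A rule: infinite_finite_induct) (auto intro: continuous_map_add)

text \<open>Continuity of addition at \<open>(0, 0)\<close>; it plays the role of halving an
  epsilon.\<close>

lemma open_add_halves:
  assumes "openin X V" "0 \<in> V"
  obtains W where "openin X W" "0 \<in> W" "\<And>x y. x \<in> W \<Longrightarrow> y \<in> W \<Longrightarrow> x + y \<in> V"
proof -
  let ?S = "{p \<in> topspace (prod_topology X X). (\<lambda>(x, y). x + y) p \<in> V}"
  have "openin (prod_topology X X) ?S"
    using continuous_add assms(1) by (rule openin_continuous_map_preimage)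
  moreover have "(0, 0) \<in> ?S"
    using assms by simp
  ultimately have "\<exists>U W. openin X U \<and> openin X W \<and> 0 \<in> U \<and> 0 \<in> W \<and> U \<times> W \<subseteq> ?S"
    by (rule openin_prod_topology_alt[THEN iffD1, rule_format])
  then obtain U W where UW: "openin X U" "openin X W" "0 \<in> U" "0 \<in> W" "U \<times> W \<subseteq> ?S"
    by blast
  have "x + y \<in> V" if "x \<in> U" "y \<in> W" for x y
    using subsetD[OF UW(5), of "(x, y)"] that by simp
  then show ?thesis
    using UW by (intro that[of "U \<inter> W"]) auto
qed

lemma open_shift:
  assumes "openin X V" "0 \<in> V" "a \<in> topspace X"
  obtains U where "openin X U" "a \<in> U" "\<And>z. z \<in> U \<Longrightarrow> z - a \<in> V"
proof
  have "continuous_map X X (\<lambda>z. z - a)"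
    using assms(3) by (intro continuous_map_diff) auto
  then show "openin X {z \<in> topspace X. z - a \<in> V}"
    using assms(1) by (rule openin_continuous_map_preimage)
qed (use assms in auto)

text \<open>\<open>V\<close> is the translate of \<open>U\<close> by \<open>-a\<close>. Membership
  of \<open>z\<close> in the carrier comes out rather than going in, since
  \<open>z = (z - a) + a\<close>.\<close>

lemma open_unshift:
  assumes "openin X U" "a \<in> U"
  obtains V where "openin X V" "0 \<in> V" "\<And>z. z - a \<in> V \<Longrightarrow> z \<in> U"
proof
  have "a \<in> topspace X"
    using assms openin_subset by blast
  then have "continuous_map X X (\<lambda>z. z + a)"
    by (intro continuous_map_add) auto
  then show "openin X {z \<in> topspace X. z + a \<in> U}"
    using assms(1) by (rule openin_continuous_map_preimage)
qed (use assms in auto)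

text \<open>Joint continuity of scaling at \<open>(c, x)\<close>. The scalar neighbourhood is hidden
  in the filter \<open>nhds c\<close>, so that finite intersections and changes of variable become
  filter arguments.\<close>

lemma eventually_scale_in:
  assumes "openin X V" "x \<in> topspace X" "scale c x \<in> V"
  obtains W where "openin X W" "x \<in> W" "\<forall>\<^sub>F d in nhds c. \<forall>z\<in>W. scale d z \<in> V"
proof -
  let ?S = "{p \<in> topspace (prod_topology euclidean X). (\<lambda>(c, x). scale c x) p \<in> V}"
  have "openin (prod_topology euclidean X) ?S"
    using continuous_scale assms(1) by (rule openin_continuous_map_preimage)
  moreover have "(c, x) \<in> ?S"
    using assms by simp
  ultimately have "\<exists>D W. openin euclidean D \<and> openin X W \<and> c \<in> D \<and> x \<in> W \<and> D \<times> W \<subseteq> ?S"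
    by (rule openin_prod_topology_alt[THEN iffD1, rule_format])
  then obtain D W where DW: "openin euclidean D" "openin X W" "c \<in> D" "x \<in> W" "D \<times> W \<subseteq> ?S"
    by blast
  have "\<forall>z\<in>W. scale d z \<in> V" if "d \<in> D" for d
    using DW(5) that by auto
  then have "\<forall>\<^sub>F d in nhds c. \<forall>z\<in>W. scale d z \<in> V"
    using DW(1,3) by (intro eventually_nhds_in_open[THEN eventually_mono, of D]) (simp_all only: open_openin)
  then show ?thesis
    using DW by (intro that) auto
qed

end

section \<open>The scalar field as an lcHs, and topologies of uniform convergence\<close>

lemma lcHs_field: "lcHs (*) (euclidean :: 'k::real_or_complex topology)"
proof -
  interpret vector_space "(*) :: 'k \<Rightarrow> 'k \<Rightarrow> 'k"
    by standard (simp_all add: algebra_simps)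
  show ?thesis
  proof
    show "module.subspace (*) (topspace (euclidean :: 'k topology))"
      by (simp add: subspace_def)
    show "topspace (euclidean :: 'k topology) \<noteq> {0}"
      by (metis UNIV_I singletonD topspace_euclidean zero_neq_one)
    show "Hausdorff_space (euclidean :: 'k topology)"
      by simp
    show "continuous_map (prod_topology euclidean euclidean) euclidean (\<lambda>(x, y). x + y :: 'k)"
      by (simp add: case_prod_unfold) (intro continuous_intros)
    show "continuous_map (prod_topology euclidean euclidean) euclidean (\<lambda>(x, y). x * y :: 'k)"
      by (simp add: case_prod_unfold) (intro continuous_intros)
  next
    fix U :: "'k set" assume "openin euclidean U" "0 \<in> U"
    then obtain e where e: "e > 0" "ball 0 e \<subseteq> U"
      by (metis open_contains_ball open_openin)
    have "of_real t * x + of_real (1 - t) * y \<in> ball 0 e"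
      if "x \<in> ball 0 e" "y \<in> ball 0 e" "t \<in> {0..1}" for x y :: 'k and t
      using convexD[OF convex_ball[of 0 e] that(1,2), of t "1 - t"] that(3)
      by (simp add: scaleR_conv_of_real)
    then have "\<forall>x\<in>ball 0 e. \<forall>y\<in>ball 0 e. \<forall>t\<in>{0..1}. of_real t * x + of_real (1 - t) * y \<in> ball (0 :: 'k) e"
      by blast
    moreover have "openin euclidean (ball (0 :: 'k) e)" "(0 :: 'k) \<in> ball 0 e"
      using e(1) by (simp_all flip: open_openin)
    ultimately show "\<exists>C V. openin euclidean V \<and> 0 \<in> V \<and> V \<subseteq> C \<and> C \<subseteq> U \<and>
        (\<forall>x\<in>C. \<forall>y\<in>C. \<forall>t\<in>{0..1}. of_real t * x + of_real (1 - t) * y \<in> C)"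
      using e(2) by (metis subset_refl)
  qed
qed

text \<open>Each value of \<open>\<phi> u\<close> on \<open>A\<close> is a value of \<open>u\<close>
  on \<open>B\<close>, at a point \<open>j\<close> independent of \<open>u\<close>. Hence a basic
  neighbourhood given by finitely many sets \<open>A\<close> contains the image of the one given by
  the corresponding sets \<open>B\<close>, with the same \<open>V\<close>. This covers both
  transposition on the dual and composition with a transpose on the
  \<open>\<epsilon>\<close>-product.\<close>

lemma continuous_map_uniform_reindex:
  assumes "0 \<in> topspace Y" "\<And>u. u \<in> M \<Longrightarrow> \<phi> u \<in> M'"
    and S: "\<And>A. A \<in> S' \<Longrightarrow> \<exists>B\<in>S. \<forall>i\<in>A. \<exists>j\<in>B. \<forall>u\<in>M. \<phi> u i = u j"
  shows "continuous_map (uniform_convergence_topology S Y M) (uniform_convergence_topology S' Y M') \<phi>"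
  unfolding continuous_map
proof (intro conjI allI impI)
  note [simp] = topspace_uniform_convergence_topology[OF assms(1)]
  show "\<phi> ` topspace (uniform_convergence_topology S Y M) \<subseteq> topspace (uniform_convergence_topology S' Y M')"
    using assms(2) by auto
  fix W assume W: "openin (uniform_convergence_topology S' Y M') W"
  show "openin (uniform_convergence_topology S Y M)
      {u \<in> topspace (uniform_convergence_topology S Y M). \<phi> u \<in> W}"
    unfolding openin_uniform_convergence_topology
  proof (intro conjI ballI)
    fix u assume "u \<in> {u \<in> topspace (uniform_convergence_topology S Y M). \<phi> u \<in> W}"
    then have u: "u \<in> M" "\<phi> u \<in> W"
      by auto
    then obtain \<A> V where \<A>: "finite \<A>" "\<A> \<subseteq> S'" "openin Y V" "0 \<in> V"
      "{v\<in>M'. \<forall>i\<in>\<Union>\<A>. v i - \<phi> u i \<in> V} \<subseteq> W"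
      using W unfolding openin_uniform_convergence_topology by blast
    obtain B where B: "\<And>A. A \<in> \<A> \<Longrightarrow> B A \<in> S \<and> (\<forall>i\<in>A. \<exists>j\<in>B A. \<forall>u\<in>M. \<phi> u i = u j)"
      using S \<A>(2) by (metis subsetD)
    have "\<phi> v \<in> W" if v: "v \<in> M" "\<forall>j\<in>\<Union>(B ` \<A>). v j - u j \<in> V" for v
    proof -
      have "\<phi> v i - \<phi> u i \<in> V" if "A \<in> \<A>" "i \<in> A" for A i
        using B[OF that(1)] that v u(1) by (metis UN_I)
      then show ?thesis
        using \<A>(5) assms(2)[OF v(1)] by blast
    qed
    then show "\<exists>\<A> V. finite \<A> \<and> \<A> \<subseteq> S \<and> openin Y V \<and> 0 \<in> V \<and> {v \<in> M. \<forall>i\<in>\<Union>\<A>. v i - u i \<in> V}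
        \<subseteq> {u \<in> topspace (uniform_convergence_topology S Y M). \<phi> u \<in> W}"
      using \<A> B by (intro exI[of _ "B ` \<A>"] exI[of _ V]) auto
  qed auto
qed

lemma vector_space_pointwise_scale:
  assumes "vector_space t"
  shows "vector_space (\<lambda>c u i. t c (u i))"
proof -
  interpret vector_space t
    by fact
  show ?thesis
    by standard (simp_all add: fun_eq_iff algebra_simps)
qed

context lcHs
begin

text \<open>The set of \<open>v\<close> with \<open>v i - u i \<in> V\<close> on
  \<open>\<Union>\<A>\<close> need not be open when \<open>\<Union>\<A>\<close> is infinite.
  \<open>W\<close> is its interior: the maps around which some uniform neighbourhood over the same
  \<open>\<A>\<close> still fits. Openness of this interior follows by halving, from
  \<open>x i - w i = (x i - v i) + (v i - w i)\<close>.\<close>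

lemma uniform_nbhd:
  assumes \<A>: "finite \<A>" "\<A> \<subseteq> S" and V: "openin X V" "0 \<in> V" and u: "u \<in> M"
  obtains W where "openin (uniform_convergence_topology S X M) W" "u \<in> W"
    "\<And>v. v \<in> W \<Longrightarrow> v \<in> M \<and> (\<forall>i\<in>\<Union>\<A>. v i - u i \<in> V)"
proof
  define N where "N V u = {v\<in>M. \<forall>i\<in>\<Union>\<A>. v i - u i \<in> V}" for V u
  let ?W = "{w\<in>M. \<exists>V'. openin X V' \<and> 0 \<in> V' \<and> N V' w \<subseteq> N V u}"
  show "openin (uniform_convergence_topology S X M) ?W"
    unfolding openin_uniform_convergence_topology
  proof (intro conjI ballI)
    fix w assume "w \<in> ?W"
    then obtain V' where V': "openin X V'" "0 \<in> V'" "N V' w \<subseteq> N V u"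
      by blast
    obtain V'' where V'': "openin X V''" "0 \<in> V''" "\<And>x y. x \<in> V'' \<Longrightarrow> y \<in> V'' \<Longrightarrow> x + y \<in> V'"
      using open_add_halves V'(1,2) by metis
    have "N V'' v \<subseteq> N V' w" if "v \<in> N V'' w" for v
    proof
      fix x assume x: "x \<in> N V'' v"
      have "x i - w i \<in> V'" if i: "i \<in> \<Union>\<A>" for i
        using V''(3)[of "x i - v i" "v i - w i"] x i \<open>v \<in> N V'' w\<close> by (auto simp: N_def)
      then show "x \<in> N V' w"
        using x by (auto simp: N_def)
    qed
    moreover have "v \<in> M" if "v \<in> N V'' w" for v
      using that by (simp add: N_def)
    ultimately have "N V'' w \<subseteq> ?W"
      using V'(3) V''(1,2) by blast
    moreover have "N V'' w = {v \<in> M. \<forall>i\<in>\<Union>\<A>. v i - w i \<in> V''}"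
      by (simp add: N_def)
    ultimately have sub: "{v \<in> M. \<forall>i\<in>\<Union>\<A>. v i - w i \<in> V''} \<subseteq> ?W"
      by simp
    then show "\<exists>\<A> V. finite \<A> \<and> \<A> \<subseteq> S \<and> openin X V \<and> 0 \<in> V \<and> {v \<in> M. \<forall>i\<in>\<Union>\<A>. v i - w i \<in> V} \<subseteq> ?W"
      by (intro exI[of _ \<A>] exI[of _ V''] conjI sub \<A> V''(1,2))
  qed auto
  show "u \<in> ?W"
    using u V by blast
  show "v \<in> M \<and> (\<forall>i\<in>\<Union>\<A>. v i - u i \<in> V)" if v: "v \<in> ?W" for v
  proof -
    obtain V' where "v \<in> M" "0 \<in> V'" "N V' v \<subseteq> N V u"
      using v by blast
    then have "v \<in> N V u"
      by (auto simp: N_def)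
    then show ?thesis
      by (simp add: N_def)
  qed
qed

text \<open>The one-element family consisting of \<open>A\<close> already controls the value at
  \<open>i\<close>, so uniform convergence on the members of \<open>S\<close> refines convergence at
  each of their points.\<close>

lemma continuous_map_evaluation:
  assumes A: "A \<in> S" "i \<in> A" and M: "\<And>u. u \<in> M \<Longrightarrow> u i \<in> topspace X"
  shows "continuous_map (uniform_convergence_topology S X M) X (\<lambda>u. u i)"
  unfolding continuous_map
proof (intro conjI allI impI)
  note [simp] = topspace_uniform_convergence_topology[OF zero_in]
  show "(\<lambda>u. u i) ` topspace (uniform_convergence_topology S X M) \<subseteq> topspace X"
    using M by auto
  fix U assume U: "openin X U"
  show "openin (uniform_convergence_topology S X M)
      {u \<in> topspace (uniform_convergence_topology S X M). u i \<in> U}"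
    unfolding openin_uniform_convergence_topology
  proof (intro conjI ballI)
    fix u assume "u \<in> {u \<in> topspace (uniform_convergence_topology S X M). u i \<in> U}"
    then obtain V where V: "openin X V" "0 \<in> V" "\<And>z. z - u i \<in> V \<Longrightarrow> z \<in> U"
      using open_unshift[OF U] by blast
    show "\<exists>\<A> V. finite \<A> \<and> \<A> \<subseteq> S \<and> openin X V \<and> 0 \<in> V \<and> {v \<in> M. \<forall>i\<in>\<Union>\<A>. v i - u i \<in> V}
        \<subseteq> {u \<in> topspace (uniform_convergence_topology S X M). u i \<in> U}"
      using A V by (intro exI[of _ "{A}"] exI[of _ V]) auto
  qed auto
qed

text \<open>
  The boundedness hypothesis is what continuity of the scalar multiplication amounts to:
  every map in \<open>M\<close> is bounded on every member of \<open>S\<close>.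
\<close>

lemma lcHs_uniform_convergence:
  fixes M :: "('i \<Rightarrow> 'a) set"
  assumes M: "module.subspace (\<lambda>c u i. scale c (u i)) M" "M \<noteq> {0}"
    and maps: "\<And>u A i. u \<in> M \<Longrightarrow> A \<in> S \<Longrightarrow> i \<in> A \<Longrightarrow> u i \<in> topspace X"
    and separating: "\<And>u v. u \<in> M \<Longrightarrow> v \<in> M \<Longrightarrow> u \<noteq> v \<Longrightarrow> \<exists>i\<in>\<Union>S. u i \<noteq> v i"
    and bounded: "\<And>u A V. u \<in> M \<Longrightarrow> A \<in> S \<Longrightarrow> openin X V \<Longrightarrow> 0 \<in> V \<Longrightarrow>
      \<forall>\<^sub>F d in nhds 0. \<forall>i\<in>A. scale d (u i) \<in> V"
  shows "lcHs (\<lambda>c u i. scale c (u i)) (uniform_convergence_topology S X M)"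
proof -
  interpret pointwise: vector_space "\<lambda>c (u :: 'i \<Rightarrow> 'a) i. scale c (u i)"
    by (rule vector_space_pointwise_scale) (rule vector_space_axioms)
  let ?T = "uniform_convergence_topology S X M"
  have top [simp]: "topspace ?T = M"
    by (rule topspace_uniform_convergence_topology) simp
  have zeroM: "0 \<in> M"
    using M(1) by (rule pointwise.subspace_0)
  have addM: "u + v \<in> M" if "u \<in> M" "v \<in> M" for u v
    using M(1) that by (rule pointwise.subspace_add)
  have scaleM: "(\<lambda>i. scale c (u i)) \<in> M" if "u \<in> M" for c u
    using M(1) that by (rule pointwise.subspace_scale)
  have nbhd: "\<exists>\<A> V. finite \<A> \<and> \<A> \<subseteq> S \<and> openin X V \<and> 0 \<in> V \<and> {v\<in>M. \<forall>i\<in>\<Union>\<A>. v i - u i \<in> V} \<subseteq> W"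
    if "openin ?T W" "u \<in> W" for W u
    using that unfolding openin_uniform_convergence_topology by blast
  show ?thesis
  proof
    show "pointwise.subspace (topspace ?T)" "topspace ?T \<noteq> {0}"
      using M by simp_all
  next
    show "Hausdorff_space ?T"
      unfolding Hausdorff_space_def
    proof (intro allI impI)
      fix u v assume "u \<in> topspace ?T \<and> v \<in> topspace ?T \<and> u \<noteq> v"
      then have uv: "u \<in> M" "v \<in> M" "u \<noteq> v"
        by auto
      then obtain A i where i: "A \<in> S" "i \<in> A" "u i \<noteq> v i"
        using separating by blast
      then obtain U V where UV: "openin X U" "openin X V" "u i \<in> U" "v i \<in> V" "disjnt U V"
        using Hausdorff maps uv unfolding Hausdorff_space_def by metis
      have "continuous_map ?T X (\<lambda>u. u i)"
        using i maps by (intro continuous_map_evaluation)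
      then have "openin ?T {w\<in>topspace ?T. w i \<in> U}" "openin ?T {w\<in>topspace ?T. w i \<in> V}"
        using UV(1,2) by (auto intro: openin_continuous_map_preimage simp del: top)
      then show "\<exists>U V. openin ?T U \<and> openin ?T V \<and> u \<in> U \<and> v \<in> V \<and> disjnt U V"
        using uv UV by (intro exI[of _ "{w\<in>topspace ?T. w i \<in> U}"] exI[of _ "{w\<in>topspace ?T. w i \<in> V}"])
          (auto simp: disjnt_iff)
    qed
  next
    show "continuous_map (prod_topology ?T ?T) ?T (\<lambda>(u, v). u + v)"
      unfolding continuous_map
    proof (intro conjI allI impI)
      show "(\<lambda>(u, v). u + v) ` topspace (prod_topology ?T ?T) \<subseteq> topspace ?T"
        using addM by auto
      fix W assume W: "openin ?T W"
      show "openin (prod_topology ?T ?T) {p \<in> topspace (prod_topology ?T ?T). (case p of (u, v) \<Rightarrow> u + v) \<in> W}"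
        unfolding openin_prod_topology_alt
      proof (intro allI impI)
        fix u v assume "(u, v) \<in> {p \<in> topspace (prod_topology ?T ?T). (case p of (u, v) \<Rightarrow> u + v) \<in> W}"
        then have uv: "u \<in> M" "v \<in> M" "u + v \<in> W"
          by auto
        obtain \<A> V where \<A>: "finite \<A>" "\<A> \<subseteq> S" and V: "openin X V" "0 \<in> V"
          and W': "{w\<in>M. \<forall>i\<in>\<Union>\<A>. w i - (u + v) i \<in> V} \<subseteq> W"
          using nbhd[OF W uv(3)] by blast
        obtain V' where V': "openin X V'" "0 \<in> V'" "\<And>x y. x \<in> V' \<Longrightarrow> y \<in> V' \<Longrightarrow> x + y \<in> V"
          using open_add_halves V by metis
        obtain W1 where W1: "openin ?T W1" "u \<in> W1"
          "\<And>w. w \<in> W1 \<Longrightarrow> w \<in> M \<and> (\<forall>i\<in>\<Union>\<A>. w i - u i \<in> V')"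
          using uniform_nbhd[OF \<A> V'(1,2) uv(1)] by blast
        obtain W2 where W2: "openin ?T W2" "v \<in> W2"
          "\<And>w. w \<in> W2 \<Longrightarrow> w \<in> M \<and> (\<forall>i\<in>\<Union>\<A>. w i - v i \<in> V')"
          using uniform_nbhd[OF \<A> V'(1,2) uv(2)] by blast
        have "w1 + w2 \<in> W" if w: "w1 \<in> W1" "w2 \<in> W2" for w1 w2
        proof -
          have "(w1 + w2) i - (u + v) i \<in> V" if "i \<in> \<Union>\<A>" for i
          proof -
            have "(w1 i - u i) + (w2 i - v i) \<in> V"
              using W1(3)[OF w(1)] W2(3)[OF w(2)] that by (blast intro: V'(3))
            then show ?thesis
              by (simp add: algebra_simps)
          qed
          then show ?thesis
            using addM[of w1 w2] W1(3)[OF w(1)] W2(3)[OF w(2)] by (intro subsetD[OF W'] CollectI) simp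
        qed
        then show "\<exists>U V. openin ?T U \<and> openin ?T V \<and> u \<in> U \<and> v \<in> V \<and>
            U \<times> V \<subseteq> {p \<in> topspace (prod_topology ?T ?T). (case p of (u, v) \<Rightarrow> u + v) \<in> W}"
          using W1 W2 by (intro exI[of _ W1] exI[of _ W2]) auto
      qed
    qed
  next
    show "continuous_map (prod_topology euclidean ?T) ?T (\<lambda>(c, u). (\<lambda>i. scale c (u i)))"
      unfolding continuous_map
    proof (intro conjI allI impI)
      show "(\<lambda>(c, u). (\<lambda>i. scale c (u i))) ` topspace (prod_topology euclidean ?T) \<subseteq> topspace ?T"
        using scaleM by auto
      fix W assume W: "openin ?T W"
      let ?R = "{p \<in> topspace (prod_topology euclidean ?T). (case p of (c, u) \<Rightarrow> (\<lambda>i. scale c (u i))) \<in> W}"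
      show "openin (prod_topology euclidean ?T) ?R"
        unfolding openin_prod_topology_alt
      proof (intro allI impI)
        fix c u assume "(c, u) \<in> ?R"
        then have u: "u \<in> M" "(\<lambda>i. scale c (u i)) \<in> W"
          by auto
        obtain \<A> V where \<A>: "finite \<A>" "\<A> \<subseteq> S" and V: "openin X V" "0 \<in> V"
          and W': "{w\<in>M. \<forall>i\<in>\<Union>\<A>. w i - scale c (u i) \<in> V} \<subseteq> W"
          using nbhd[OF W u(2)] by blast
        obtain V' where V': "openin X V'" "0 \<in> V'" "\<And>x y. x \<in> V' \<Longrightarrow> y \<in> V' \<Longrightarrow> x + y \<in> V"
          using open_add_halves V by metis
        \<comment> \<open>The estimate rests on the splitting
          \<open>d w i - c u i = d (w i - u i) + (d - c) u i\<close>. Continuity of scaling at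
          \<open>(c, 0)\<close> yields \<open>V''\<close> for the first summand; boundedness of
          \<open>u\<close> on the members of \<open>\<A>\<close>, transported from
          \<open>nhds 0\<close> to \<open>nhds c\<close>, handles the second.\<close>
        obtain V'' where V'': "openin X V''" "0 \<in> V''" "\<forall>\<^sub>F d in nhds c. \<forall>z\<in>V''. scale d z \<in> V'"
          using eventually_scale_in[of V' 0 c] V' by auto
        have "\<forall>\<^sub>F d in nhds 0. \<forall>A\<in>\<A>. \<forall>i\<in>A. scale d (u i) \<in> V'"
          using \<A> bounded u(1) V' by (intro eventually_ball_finite) auto
        moreover have "filterlim (\<lambda>d. d - c) (nhds 0) (nhds c)"
          by (rule tendsto_eq_intros filterlim_ident refl)+ simp
        ultimately have "\<forall>\<^sub>F d in nhds c. \<forall>A\<in>\<A>. \<forall>i\<in>A. scale (d - c) (u i) \<in> V'"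
          by (rule eventually_compose_filterlim)
        with V''(3) have "\<forall>\<^sub>F d in nhds c. (\<forall>z\<in>V''. scale d z \<in> V') \<and> (\<forall>A\<in>\<A>. \<forall>i\<in>A. scale (d - c) (u i) \<in> V')"
          by (rule eventually_conj)
        then obtain D where D: "open D" "c \<in> D" "\<And>d z. d \<in> D \<Longrightarrow> z \<in> V'' \<Longrightarrow> scale d z \<in> V'"
          "\<And>d i. d \<in> D \<Longrightarrow> i \<in> \<Union>\<A> \<Longrightarrow> scale (d - c) (u i) \<in> V'"
          unfolding eventually_nhds by blast
        obtain W1 where W1: "openin ?T W1" "u \<in> W1"
          "\<And>w. w \<in> W1 \<Longrightarrow> w \<in> M \<and> (\<forall>i\<in>\<Union>\<A>. w i - u i \<in> V'')"
          using uniform_nbhd[OF \<A> V''(1,2) u(1)] by blast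
        have "(\<lambda>i. scale d (w i)) \<in> W" if w: "d \<in> D" "w \<in> W1" for d w
        proof -
          have "scale d (w i) - scale c (u i) \<in> V" if "i \<in> \<Union>\<A>" for i
          proof -
            have "scale d (w i - u i) + scale (d - c) (u i) \<in> V"
              using D(3,4) W1(3)[OF w(2)] w(1) that by (blast intro: V'(3))
            then show ?thesis
              by (simp add: scale_right_diff_distrib scale_left_diff_distrib)
          qed
          then show ?thesis
            using scaleM[of w d] W1(3)[OF w(2)] by (intro subsetD[OF W'] CollectI) simp
        qed
        then show "\<exists>U V. openin euclidean U \<and> openin ?T V \<and> c \<in> U \<and> u \<in> V \<and> U \<times> V \<subseteq> ?R"
          using W1 D(1,2) by (intro exI[of _ D] exI[of _ W1]) (auto simp flip: open_openin)
      qed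
    qed
  next
    fix U assume U: "openin ?T U" "0 \<in> U"
    obtain \<A> V where \<A>: "finite \<A>" "\<A> \<subseteq> S" and V: "openin X V" "0 \<in> V"
      and V_U: "{w\<in>M. \<forall>i\<in>\<Union>\<A>. w i - 0 i \<in> V} \<subseteq> U"
      using nbhd[OF U] by blast
    obtain C V' where V': "openin X V'" "0 \<in> V'" "V' \<subseteq> C" "C \<subseteq> V"
      and C: "\<forall>x\<in>C. \<forall>y\<in>C. \<forall>t\<in>{0..1}. scale (of_real t) x + scale (of_real (1 - t)) y \<in> C"
      using locally_convex[OF V] by blast
    obtain W where W: "openin ?T W" "0 \<in> W" "\<And>w. w \<in> W \<Longrightarrow> w \<in> M \<and> (\<forall>i\<in>\<Union>\<A>. w i - 0 i \<in> V')"
      using uniform_nbhd[OF \<A> V'(1,2) zeroM] by blast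
    \<comment> \<open>Convexity is inherited pointwise from \<open>C\<close>. Neither
      \<open>C\<close> nor \<open>?C\<close> has to be open: the open set \<open>W\<close> inside
      \<open>?C\<close> provides the neighbourhood.\<close>
    let ?C = "{w\<in>M. \<forall>i\<in>\<Union>\<A>. w i \<in> C}"
    have "W \<subseteq> ?C"
      using W(3) V'(3) by auto
    moreover have "?C \<subseteq> U"
      using V_U V'(4) by auto
    moreover have "(\<lambda>i. scale (of_real t) (x i)) + (\<lambda>i. scale (of_real (1 - t)) (y i)) \<in> ?C"
      if "x \<in> ?C" "y \<in> ?C" "t \<in> {0..1}" for x y t
    proof -
      have "scale (of_real t) (x i) + scale (of_real (1 - t)) (y i) \<in> C" if "i \<in> \<Union>\<A>" for i
        using C \<open>x \<in> ?C\<close> \<open>y \<in> ?C\<close> \<open>t \<in> {0..1}\<close> that by blast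
      moreover have "(\<lambda>i. scale (of_real t) (x i)) + (\<lambda>i. scale (of_real (1 - t)) (y i)) \<in> M"
        using that by (auto intro: addM scaleM)
      ultimately show ?thesis
        by auto
    qed
    ultimately show "\<exists>C V. openin ?T V \<and> 0 \<in> V \<and> V \<subseteq> C \<and> C \<subseteq> U \<and>
      (\<forall>x\<in>C. \<forall>y\<in>C. \<forall>t\<in>{0..1}. (\<lambda>i. scale (of_real t) (x i)) + (\<lambda>i. scale (of_real (1 - t)) (y i)) \<in> C)"
      using W(1,2) by (intro exI[of _ ?C] exI[of _ W]) auto
  qed
qed

end

section \<open>Algebra of continuous linear maps and convergence in uniform topologies\<close>

lemma linear_maps_add:
  "u \<in> linear_maps s X t Y \<Longrightarrow> x \<in> topspace X \<Longrightarrow> y \<in> topspace X \<Longrightarrow> u (x + y) = u x + u y"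
  by (simp add: linear_maps_def continuous_linear_def)

lemma linear_maps_scale:
  "u \<in> linear_maps s X t Y \<Longrightarrow> x \<in> topspace X \<Longrightarrow> u (s c x) = t c (u x)"
  by (simp add: linear_maps_def continuous_linear_def)

lemma linear_maps_outside: "u \<in> linear_maps s X t Y \<Longrightarrow> x \<notin> topspace X \<Longrightarrow> u x = 0"
  by (simp add: linear_maps_def)

lemma linear_maps_continuous: "u \<in> linear_maps s X t Y \<Longrightarrow> continuous_map X Y u"
  by (simp add: linear_maps_def continuous_linear_def)

lemma linear_maps_in: "u \<in> linear_maps s X t Y \<Longrightarrow> x \<in> topspace X \<Longrightarrow> u x \<in> topspace Y"
  by (auto simp: linear_maps_def continuous_linear_def continuous_map_def)

text \<open>The carrier of \<open>X\<close> is arbitrary here, so 0 may lie outside it; in that case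
  the convention of extension by zero gives the value.\<close>

lemma linear_maps_zero:
  assumes "u \<in> linear_maps s X t Y"
  shows "u 0 = 0"
proof (cases "0 \<in> topspace X")
  case True
  then show ?thesis
    using linear_maps_add[OF assms True True] by simp
qed (rule linear_maps_outside[OF assms])

lemma linear_maps_diff:
  assumes u: "u \<in> linear_maps s X t Y" and "x \<in> topspace X" "y \<in> topspace X" "x - y \<in> topspace X"
  shows "u (x - y) = u x - u y"
  using linear_maps_add[OF u, of "x - y" y] assms by (simp add: algebra_simps)

text \<open>Stated from a vector space and a subspace instead of \<open>lcHs\<close>, because it is
  applied both to functionals on \<open>F\<close> and to maps on the dual with the topology
  \<open>dual_kappa\<close>, where only the linear structure is at hand.\<close>

lemma linear_maps_sum:
  assumes "vector_space s" "module.subspace s (topspace X)" and u: "u \<in> linear_maps s X t Y"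
    and g: "\<And>i. i \<in> A \<Longrightarrow> g i \<in> topspace X"
  shows "u (\<Sum>i\<in>A. s (c i) (g i)) = (\<Sum>i\<in>A. t (c i) (u (g i)))"
  using g
proof (induction A rule: infinite_finite_induct)
  case (insert i A)
  interpret vector_space s
    by fact
  have "s (c i) (g i) \<in> topspace X" "(\<Sum>i\<in>A. s (c i) (g i)) \<in> topspace X"
    using insert.prems by (auto intro!: subspace_sum subspace_scale assms(2))
  then show ?case
    using insert by (simp add: linear_maps_add[OF u] linear_maps_scale[OF u])
qed (simp_all add: linear_maps_zero[OF u])

lemma (in lcHs) subspace_linear_maps:
  fixes T :: "'i::ab_group_add topology"
  shows "module.subspace (\<lambda>c u i. scale c (u i)) (linear_maps s T scale X)"
proof -
  interpret pointwise: vector_space "\<lambda>c (u :: 'i \<Rightarrow> 'a) i. scale c (u i)"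
    by (rule vector_space_pointwise_scale) (rule vector_space_axioms)
  show ?thesis
    unfolding pointwise.subspace_def linear_maps_def continuous_linear_def
    by (auto simp: algebra_simps zero_fun_def plus_fun_def mult.commute
        intro!: continuous_map_add continuous_map_scale)
qed

lemma limitin_uniform_convergence:
  assumes "u \<in> M" "\<And>k. g k \<in> M" and zero: "0 \<in> topspace Y"
    and conv: "\<And>A V. A \<in> S \<Longrightarrow> openin Y V \<Longrightarrow> 0 \<in> V \<Longrightarrow> \<forall>\<^sub>F k in G. \<forall>i\<in>A. g k i - u i \<in> V"
  shows "limitin (uniform_convergence_topology S Y M) g u G"
  unfolding limitin_def
proof (intro conjI allI impI)
  show "u \<in> topspace (uniform_convergence_topology S Y M)"
    by (simp add: topspace_uniform_convergence_topology[OF zero] assms(1))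
  fix W assume W: "openin (uniform_convergence_topology S Y M) W \<and> u \<in> W"
  then obtain \<A> V where \<A>: "finite \<A>" "\<A> \<subseteq> S" "openin Y V" "0 \<in> V"
    "{v\<in>M. \<forall>i\<in>\<Union>\<A>. v i - u i \<in> V} \<subseteq> W"
    unfolding openin_uniform_convergence_topology by blast
  have "\<forall>\<^sub>F k in G. \<forall>A\<in>\<A>. \<forall>i\<in>A. g k i - u i \<in> V"
    using \<A> by (intro eventually_ball_finite) (auto intro: conv)
  then show "\<forall>\<^sub>F k in G. g k \<in> W"
    by (rule eventually_mono) (use \<A>(5) assms(2) in blast)
qed

section \<open>The dual \<open>F'\<close>, the space \<open>F \<epsilon> E\<close> and its lcHs
  structure\<close>

locale lcHs_pair = F: lcHs sF F + E: lcHs sE E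
  for sF :: "'k::real_or_complex \<Rightarrow> 'f::ab_group_add \<Rightarrow> 'f" and F :: "'f topology"
    and sE :: "'k \<Rightarrow> 'e::ab_group_add \<Rightarrow> 'e" and E :: "'e topology"
begin

sublocale scalars: lcHs "(*) :: 'k \<Rightarrow> 'k \<Rightarrow> 'k" euclidean
  by (rule lcHs_field)

sublocale dual: vector_space "\<lambda>c (y :: 'f \<Rightarrow> 'k) x. c * y x"
  by (rule vector_space_pointwise_scale) (rule vector_space_over_itself.vector_space_axioms)

abbreviation "eps_maps \<equiv> linear_maps (\<lambda>c y x. c * y x) (dual_kappa sF F) sE E"

lemma topspace_dual_kappa [simp]: "topspace (dual_kappa sF F) = dual sF F"
  unfolding dual_kappa_def by (rule topspace_uniform_convergence_topology) simp

lemma topspace_eps_product [simp]: "topspace (eps_product sF F sE E) = eps_maps"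
  unfolding eps_product_def by (rule topspace_uniform_convergence_topology) simp

lemma subspace_dual: "dual.subspace (dual sF F)"
  unfolding dual_def by (rule scalars.subspace_linear_maps)

lemma subspace_eps_maps: "module.subspace (\<lambda>c u y. sE c (u y)) eps_maps"
  by (rule E.subspace_linear_maps)

lemmas dual_scale_in = dual.subspace_scale[OF subspace_dual]

text \<open>Continuity at 0 supplies finitely many absolutely convex compact sets. Their union
  \<open>K\<close> is compact, though possibly no longer convex; compactness is what the later
  estimates use.\<close>

lemma eps_maps_bound:
  assumes u: "u \<in> eps_maps" and V: "openin E V" "0 \<in> V"
  obtains K e where "compactin F K" "e > 0"
    "\<forall>y\<in>dual sF F. (\<forall>x\<in>K. norm (y x) < e) \<longrightarrow> u y \<in> V"
proof -
  have "openin (dual_kappa sF F) {y \<in> topspace (dual_kappa sF F). u y \<in> V}"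
    using linear_maps_continuous[OF u] V(1) by (rule openin_continuous_map_preimage)
  moreover have "0 \<in> {y \<in> topspace (dual_kappa sF F). u y \<in> V}"
    using V(2) linear_maps_zero[OF u] dual.subspace_0[OF subspace_dual] by simp
  ultimately obtain \<A> V' where \<A>: "finite \<A>" "\<A> \<subseteq> {A. compactin F A \<and> absolutely_convex sF A}"
    and V': "openin euclidean V'" "0 \<in> V'"
    and sub: "{y \<in> dual sF F. \<forall>x\<in>\<Union>\<A>. y x - 0 x \<in> V'} \<subseteq> {y \<in> topspace (dual_kappa sF F). u y \<in> V}"
    unfolding dual_kappa_def openin_uniform_convergence_topology by blast
  obtain e where e: "e > 0" "ball 0 e \<subseteq> V'"
    using V' by (metis open_contains_ball open_openin)
  show ?thesis
  proof
    show "compactin F (\<Union>\<A>)"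
      using \<A> by (intro compactin_Union) auto
    show "\<forall>y\<in>dual sF F. (\<forall>x\<in>\<Union>\<A>. norm (y x) < e) \<longrightarrow> u y \<in> V"
    proof (intro ballI impI)
      fix y assume y: "y \<in> dual sF F" and small: "\<forall>x\<in>\<Union>\<A>. norm (y x) < e"
      have "y x - 0 x \<in> V'" if "x \<in> \<Union>\<A>" for x
        using bspec[OF small that] e(2) by auto
      then have "y \<in> {y \<in> dual sF F. \<forall>x\<in>\<Union>\<A>. y x - 0 x \<in> V'}"
        using y by (intro CollectI conjI ballI)
      from subsetD[OF sub this] show "u y \<in> V"
        by simp
    qed
  qed (rule e(1))
qed

lemma equicontinuous_bound:
  assumes H: "H \<subseteq> dual sF F" "equicontinuous F euclidean H" and "e > 0"
  obtains U where "openin F U" "0 \<in> U" "\<forall>y\<in>H. \<forall>z\<in>U. norm (y z) < e"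
proof -
  have "openin euclidean (ball (0 :: 'k) e)" "0 \<in> ball (0 :: 'k) e"
    using \<open>e > 0\<close> by (simp_all flip: open_openin)
  then obtain U where U: "openin F U" "0 \<in> U" "\<forall>y\<in>H. \<forall>z\<in>U. y z - y 0 \<in> ball 0 e"
    using H(2) F.zero_in unfolding equicontinuous_def by metis
  have "norm (y z) < e" if "y \<in> H" "z \<in> U" for y z
  proof -
    have "y 0 = 0"
      using that(1) H(1) linear_maps_zero unfolding dual_def by blast
    moreover have "y z - y 0 \<in> ball 0 e"
      using U(3) that by blast
    ultimately show ?thesis
      by simp
  qed
  then show ?thesis
    using U(1,2) by (intro that) auto
qed

text \<open>This is the boundedness condition behind continuity of scaling on
  \<open>F \<epsilon> E\<close>. Since \<open>K\<close> is compact, \<open>d K\<close> lies in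
  \<open>U\<close> for all small \<open>d\<close>; as \<open>d * y x = y (sF d x)\<close>, the
  functional \<open>d y\<close> is then smaller than \<open>e\<close> on \<open>K\<close> for every
  \<open>y \<in> H\<close>, which forces \<open>sE d (u y) \<in> V\<close>.\<close>

lemma eps_maps_bounded:
  assumes u: "u \<in> eps_maps" and H: "H \<subseteq> dual sF F" "equicontinuous F euclidean H"
    and V: "openin E V" "0 \<in> V"
  shows "\<forall>\<^sub>F d in nhds 0. \<forall>y\<in>H. sE d (u y) \<in> V"
proof -
  obtain K e where K: "compactin F K" "e > 0"
    "\<forall>y\<in>dual sF F. (\<forall>x\<in>K. norm (y x) < e) \<longrightarrow> u y \<in> V"
    by (rule eps_maps_bound[OF u V])
  have K_sub: "K \<subseteq> topspace F"
    using K(1) by (rule compactin_subset_topspace)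
  obtain U where U: "openin F U" "0 \<in> U" "\<forall>y\<in>H. \<forall>z\<in>U. norm (y z) < e"
    by (rule equicontinuous_bound[OF H K(2)])
  have "\<forall>\<^sub>F d in nhds 0. \<forall>z\<in>K. sF d z \<in> U"
    using K(1)
  proof (rule compactin_eventually_ball)
    fix x assume "x \<in> K"
    then have x: "x \<in> topspace F"
      using K_sub by blast
    have "sF 0 x \<in> U"
      using U(2) by simp
    then obtain W where "openin F W" "x \<in> W" "\<forall>\<^sub>F d in nhds 0. \<forall>z\<in>W. sF d z \<in> U"
      by (rule F.eventually_scale_in[OF U(1) x])
    then show "\<exists>W. openin F W \<and> x \<in> W \<and> (\<forall>\<^sub>F d in nhds 0. \<forall>z\<in>W. sF d z \<in> U)"
      by (intro exI[of _ W] conjI)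
  qed
  then show ?thesis
  proof (rule eventually_mono, intro ballI)
    fix d y assume d: "\<forall>z\<in>K. sF d z \<in> U" and y: "y \<in> H"
    then have yD: "y \<in> dual sF F"
      using H(1) by blast
    have "norm (d * y x) < e" if "x \<in> K" for x
    proof -
      have "d * y x = y (sF d x)"
        using linear_maps_scale yD K_sub that unfolding dual_def by (metis subsetD)
      then show ?thesis
        using U(3) y d that by simp
    qed
    then have "u (\<lambda>x. d * y x) \<in> V"
      by (intro K(3)[rule_format] dual_scale_in yD)
    then show "sE d (u y) \<in> V"
      using linear_maps_scale[OF u, of y d] yD by simp
  qed
qed

text \<open>The multiples \<open>c x\<close> with \<open>norm c \<le> 1\<close> form an absolutely
  convex set containing \<open>x\<close>, and it is compact as a continuous image of the closed unit
  ball of scalars. So it is one of the sets defining \<open>dual_kappa\<close>.\<close>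

lemma continuous_map_dual_evaluation:
  assumes x: "x \<in> topspace F"
  shows "continuous_map (dual_kappa sF F) euclidean (\<lambda>y. y x)"
  unfolding dual_kappa_def
proof (rule scalars.continuous_map_evaluation)
  let ?A = "(\<lambda>c. sF c x) ` cball 0 1"
  have "continuous_map euclidean F (\<lambda>c. sF c x)"
    using x by (intro F.continuous_map_scale) auto
  then have "compactin F ?A"
    by (intro image_compactin[of euclidean]) auto
  moreover have "absolutely_convex sF ?A"
    unfolding absolutely_convex_def
  proof (intro ballI allI impI)
    fix v w and a b :: 'k assume v: "v \<in> ?A" and w: "w \<in> ?A" and ab: "norm a + norm b \<le> 1"
    obtain c where c: "v = sF c x" "norm c \<le> 1"
      using v by (metis imageE mem_cball_0)
    obtain d where d: "w = sF d x" "norm d \<le> 1"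
      using w by (metis imageE mem_cball_0)
    have "norm (a * c + b * d) \<le> norm a * norm c + norm b * norm d"
      by (metis norm_mult norm_triangle_ineq)
    also have "\<dots> \<le> norm a + norm b"
      using c(2) d(2) by (intro add_mono mult_left_le) auto
    finally have "a * c + b * d \<in> cball 0 1"
      using ab by simp
    moreover have "sF a v + sF b w = sF (a * c + b * d) x"
      by (simp add: c(1) d(1) F.scale_left_distrib)
    ultimately show "sF a v + sF b w \<in> ?A"
      by blast
  qed
  ultimately show "?A \<in> {A. compactin F A \<and> absolutely_convex sF A}"
    by simp
  show "x \<in> ?A"
    by (rule image_eqI[of _ _ 1]) auto
qed simp

text \<open>Each summand is a point evaluation on the dual followed by scaling a fixed vector of
  \<open>E\<close>, hence continuous on \<open>dual_kappa\<close>. The canonical map from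
  \<open>F \<otimes> E\<close> therefore lands in the \<open>\<epsilon>\<close>-product.\<close>

lemma tensor_in_eps_maps:
  assumes "\<And>n. n < N \<Longrightarrow> g n \<in> topspace F \<and> e n \<in> topspace E"
  shows "(\<lambda>y. if y \<in> dual sF F then \<Sum>n<N. sE (y (g n)) (e n) else 0) \<in> eps_maps" (is "?u \<in> _")
proof -
  have "continuous_map (dual_kappa sF F) E (\<lambda>y. \<Sum>n<N. sE (y (g n)) (e n))"
    using assms by (intro E.continuous_map_sum E.continuous_map_scale continuous_map_dual_evaluation) auto
  then have "continuous_map (dual_kappa sF F) E ?u"
    by (rule continuous_map_eq) simp
  then show ?thesis
    unfolding linear_maps_def continuous_linear_def
    using dual_scale_in dual.subspace_add[OF subspace_dual]
    by (auto simp: E.scale_left_distrib sum.distrib E.scale_sum_right)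
qed

lemma tensor_product_subset: "tensor_product sF F sE E \<subseteq> eps_maps"
  unfolding tensor_product_def using tensor_in_eps_maps by blast

text \<open>Makes the topology of \<open>F \<epsilon> E\<close> finer than pointwise convergence on
  the dual, whence its Hausdorff property and the continuity of evaluations.\<close>

lemma equicontinuous_singleton:
  assumes "y \<in> dual sF F"
  shows "equicontinuous F euclidean {y}"
  unfolding equicontinuous_def
proof (intro ballI allI impI)
  fix x and V :: "'k set" assume x: "x \<in> topspace F" and V: "openin euclidean V \<and> 0 \<in> V"
  have "continuous_map F euclidean (\<lambda>z. y z - y x)"
    using linear_maps_continuous assms unfolding dual_def by (intro scalars.continuous_map_diff) auto
  then have "openin F {z \<in> topspace F. y z - y x \<in> V}"
    using V by (intro openin_continuous_map_preimage) auto
  then show "\<exists>U. openin F U \<and> x \<in> U \<and> (\<forall>h\<in>{y}. \<forall>z\<in>U. h z - h x \<in> V)"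
    using x V by (intro exI[of _ "{z \<in> topspace F. y z - y x \<in> V}"]) auto
qed

lemma continuous_map_eps_evaluation:
  assumes "y \<in> dual sF F"
  shows "continuous_map (eps_product sF F sE E) E (\<lambda>u. u y)"
  unfolding eps_product_def
proof (rule E.continuous_map_evaluation)
  show "{y} \<in> {H. H \<subseteq> dual sF F \<and> equicontinuous F euclidean H}"
    using assms equicontinuous_singleton by simp
qed (use assms linear_maps_in in fastforce)+

text \<open>A nonzero functional \<open>y\<close> with \<open>y x \<noteq> 0\<close> makes the
  elementary tensor \<open>x \<otimes> e\<close> nonzero, so the product is non-trivial. A
  coefficient functional of the basis later plays the role of \<open>y\<close>.\<close>

lemma lcHs_eps_product:
  assumes "dual sF F \<noteq> {0}"
  shows "lcHs (eps_scale sE) (eps_product sF F sE E)"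
proof -
  obtain y where y: "y \<in> dual sF F" "y \<noteq> 0"
    using assms dual.subspace_0[OF subspace_dual] by blast
  then obtain x where x: "y x \<noteq> 0"
    by (auto simp: fun_eq_iff)
  then have x_in: "x \<in> topspace F"
    using y(1) linear_maps_outside unfolding dual_def by metis
  obtain e where e: "e \<in> topspace E" "e \<noteq> 0"
    using E.nontrivial E.zero_in by blast
  have "eps_maps \<noteq> {0}"
  proof
    let ?u = "\<lambda>y. if y \<in> dual sF F then \<Sum>n<1::nat. sE (y x) e else 0"
    assume "eps_maps = {0}"
    moreover have "?u \<in> eps_maps"
      using x_in e(1) by (intro tensor_in_eps_maps) simp
    ultimately have "?u = 0"
      by (simp only: singleton_iff)
    then have "?u y = 0 y"
      by (rule fun_cong)
    then show False
      using y(1) x e(2) by simp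
  qed
  then have "lcHs (\<lambda>c u y. sE c (u y)) (eps_product sF F sE E)"
    unfolding eps_product_def
  proof (intro E.lcHs_uniform_convergence subspace_eps_maps)
    fix u v assume uv: "u \<in> eps_maps" "v \<in> eps_maps" "u \<noteq> v"
    then obtain y where "u y \<noteq> v y"
      by blast
    moreover from this have "y \<in> dual sF F"
      using uv linear_maps_outside by (metis topspace_dual_kappa)
    ultimately show "\<exists>y\<in>\<Union>{H. H \<subseteq> dual sF F \<and> equicontinuous F euclidean H}. u y \<noteq> v y"
      using equicontinuous_singleton by (intro bexI[of _ y] UnionI[of "{y}"]) auto
  next
    fix u H y assume "u \<in> eps_maps" "H \<in> {H. H \<subseteq> dual sF F \<and> equicontinuous F euclidean H}" "y \<in> H"
    then show "u y \<in> topspace E"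
      using linear_maps_in by fastforce
  next
    fix u H V assume "u \<in> eps_maps" "H \<in> {H. H \<subseteq> dual sF F \<and> equicontinuous F euclidean H}"
      "openin E V" "0 \<in> V"
    then show "\<forall>\<^sub>F d in nhds 0. \<forall>y\<in>H. sE d (u y) \<in> V"
      by (intro eps_maps_bounded) auto
  qed
  then show ?thesis
    by (simp add: eps_scale_def[abs_def])
qed

section \<open>Transposes and the operators \<open>T \<epsilon> id\<close>\<close>

lemma comp_in_dual:
  assumes T: "T \<in> linear_maps sF F sF F" and y: "y \<in> dual sF F"
  shows "y \<circ> T \<in> dual sF F"
proof -
  note y' = y[unfolded dual_def]
  have "continuous_map F euclidean (y \<circ> T)"
    using linear_maps_continuous[OF T] linear_maps_continuous[OF y'] by (rule continuous_map_compose)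
  then show ?thesis
    unfolding dual_def
    by (subst linear_maps_def) (simp add: continuous_linear_def linear_maps_add[OF T] linear_maps_add[OF y']
      linear_maps_scale[OF T] linear_maps_scale[OF y'] linear_maps_in[OF T] linear_maps_outside[OF T]
      linear_maps_zero[OF y'])
qed

lemma continuous_map_transposed:
  assumes T: "T \<in> linear_maps sF F sF F"
  shows "continuous_map (dual_kappa sF F) (dual_kappa sF F) (transposed sF F T)"
  unfolding dual_kappa_def
proof (rule continuous_map_uniform_reindex)
  show "transposed sF F T y \<in> dual sF F" if "y \<in> dual sF F" for y
    using that comp_in_dual[OF T] by (simp add: transposed_def)
next
  fix A assume A: "A \<in> {A. compactin F A \<and> absolutely_convex sF A}"
  then have A_sub: "A \<subseteq> topspace F"
    using compactin_subset_topspace by blast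
  have "compactin F (T ` A)"
    using A linear_maps_continuous[OF T] by (intro image_compactin) auto
  moreover have "absolutely_convex sF (T ` A)"
    unfolding absolutely_convex_def
  proof (intro ballI allI impI)
    fix v w and a b :: 'k assume "v \<in> T ` A" "w \<in> T ` A" and ab: "norm a + norm b \<le> 1"
    then obtain x z where xz: "v = T x" "w = T z" "x \<in> A" "z \<in> A"
      by blast
    then have "x \<in> topspace F" "z \<in> topspace F"
      using A_sub by blast+
    then have "sF a v + sF b w = T (sF a x + sF b z)"
      by (simp add: xz(1,2) linear_maps_add[OF T] linear_maps_scale[OF T])
    moreover have "sF a x + sF b z \<in> A"
      using A xz(3,4) ab by (simp add: absolutely_convex_def)
    ultimately show "sF a v + sF b w \<in> T ` A"
      by simp
  qed
  ultimately have "T ` A \<in> {A. compactin F A \<and> absolutely_convex sF A}"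
    by simp
  then show "\<exists>B\<in>{A. compactin F A \<and> absolutely_convex sF A}.
      \<forall>x\<in>A. \<exists>z\<in>B. \<forall>y\<in>dual sF F. transposed sF F T y x = y z"
    by (rule bexI[rotated]) (auto simp: transposed_def)
qed simp

lemma eps_id_in_eps_maps:
  assumes T: "T \<in> linear_maps sF F sF F" and u: "u \<in> eps_maps"
  shows "eps_id sF F T u \<in> eps_maps"
proof -
  have "continuous_map (dual_kappa sF F) E (eps_id sF F T u)"
    unfolding eps_id_def using continuous_map_transposed[OF T] linear_maps_continuous[OF u]
    by (rule continuous_map_compose)
  moreover have add: "eps_id sF F T u (y + z) = eps_id sF F T u y + eps_id sF F T u z"
    if "y \<in> dual sF F" "z \<in> dual sF F" for y z
  proof -
    have "transposed sF F T (y + z) = (y \<circ> T) + (z \<circ> T)"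
      using that dual.subspace_add[OF subspace_dual] by (simp add: transposed_def fun_eq_iff)
    then show ?thesis
      using that linear_maps_add[OF u] comp_in_dual[OF T] by (simp add: eps_id_def transposed_def)
  qed
  moreover have scale: "eps_id sF F T u (\<lambda>x. c * y x) = sE c (eps_id sF F T u y)"
    if "y \<in> dual sF F" for c y
  proof -
    have "transposed sF F T (\<lambda>x. c * y x) = (\<lambda>x. c * (y \<circ> T) x)"
      using that dual_scale_in by (simp add: transposed_def fun_eq_iff)
    then show ?thesis
      using that linear_maps_scale[OF u, of "y \<circ> T" c] comp_in_dual[OF T that]
      by (simp add: eps_id_def transposed_def)
  qed
  moreover have "eps_id sF F T u y = 0" if "y \<notin> dual sF F" for y
    using that linear_maps_zero[OF u] by (simp add: eps_id_def transposed_def)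
  ultimately show ?thesis
    by (subst linear_maps_def) (simp add: continuous_linear_def)
qed

text \<open>Equicontinuity of \<open>H\<close> at \<open>T x\<close> yields \<open>U\<close>, and
  the preimage of \<open>U\<close> under \<open>T\<close> works at \<open>x\<close> for all
  transposed functionals at once.\<close>

lemma equicontinuous_transposed:
  assumes H: "H \<subseteq> dual sF F" "equicontinuous F euclidean H" and T: "T \<in> linear_maps sF F sF F"
  shows "equicontinuous F euclidean (transposed sF F T ` H)"
  unfolding equicontinuous_def
proof (intro ballI allI impI)
  fix x and V :: "'k set" assume x: "x \<in> topspace F" and V: "openin euclidean V \<and> 0 \<in> V"
  then obtain U where U: "openin F U" "T x \<in> U" "\<forall>h\<in>H. \<forall>z\<in>U. h z - h (T x) \<in> V"
    using H(2) linear_maps_in[OF T x] unfolding equicontinuous_def by meson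
  have "openin F {z \<in> topspace F. T z \<in> U}"
    using linear_maps_continuous[OF T] U(1) by (rule openin_continuous_map_preimage)
  moreover have "h z - h x \<in> V" if "h \<in> transposed sF F T ` H" "T z \<in> U" for h z
    using that U(3) H(1) by (auto simp: transposed_def subset_iff)
  ultimately show "\<exists>U. openin F U \<and> x \<in> U \<and> (\<forall>h\<in>transposed sF F T ` H. \<forall>z\<in>U. h z - h x \<in> V)"
    using x U(2) by (intro exI[of _ "{z \<in> topspace F. T z \<in> U}"]) simp
qed

text \<open>The values of \<open>eps_id sF F T u\<close> on \<open>H\<close> are those of
  \<open>u\<close> on the transposed set, which is again equicontinuous. Linearity is immediate
  because the operator is a precomposition.\<close>

lemma continuous_linear_eps_id:
  assumes T: "T \<in> linear_maps sF F sF F"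
  shows "continuous_linear (eps_scale sE) (eps_product sF F sE E)
    (eps_scale sE) (eps_product sF F sE E) (eps_id sF F T)"
proof -
  have "continuous_map (eps_product sF F sE E) (eps_product sF F sE E) (eps_id sF F T)"
    unfolding eps_product_def
  proof (rule continuous_map_uniform_reindex)
    fix H assume H: "H \<in> {H. H \<subseteq> dual sF F \<and> equicontinuous F euclidean H}"
    then have "transposed sF F T ` H \<in> {H. H \<subseteq> dual sF F \<and> equicontinuous F euclidean H}"
      using equicontinuous_transposed[OF _ _ T] comp_in_dual[OF T]
      by (auto simp: transposed_def subset_iff)
    then show "\<exists>B\<in>{H. H \<subseteq> dual sF F \<and> equicontinuous F euclidean H}.
        \<forall>y\<in>H. \<exists>z\<in>B. \<forall>u\<in>eps_maps. eps_id sF F T u y = u z"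
      by (rule bexI[rotated]) (auto simp: eps_id_def)
  qed (auto intro: eps_id_in_eps_maps[OF T])
  then show ?thesis
    by (simp add: continuous_linear_def eps_id_def eps_scale_def fun_eq_iff)
qed

section \<open>From pointwise convergence on \<open>F\<close> to convergence on
  \<open>F \<epsilon> E\<close>\<close>

lemma uniform_convergence_on_compact:
  assumes T: "equicontinuous F F (range T)"
    and lim: "\<And>x. x \<in> topspace F \<Longrightarrow> limitin F (\<lambda>k. T k x) x sequentially"
    and K: "compactin F K" and U: "openin F U" "0 \<in> U"
  shows "\<forall>\<^sub>F k in sequentially. \<forall>x\<in>K. T k x - x \<in> U"
  using K
proof (rule compactin_eventually_ball)
  fix x assume "x \<in> K"
  then have x: "x \<in> topspace F"
    using compactin_subset_topspace[OF K] by blast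
  \<comment> \<open>Near \<open>x\<close>, write \<open>T k z - z\<close> as
    \<open>(T k z - T k x) + (T k x - x) + (x - z)\<close>. The first term is small for all
    \<open>k\<close> by equicontinuity, the second for large \<open>k\<close> by the limit at
    \<open>x\<close>, the third for \<open>z\<close> close to \<open>x\<close>. The first two share
    \<open>U1\<close>, hence the second halving.\<close>
  obtain U1 where U1: "openin F U1" "0 \<in> U1" "\<And>v w. v \<in> U1 \<Longrightarrow> w \<in> U1 \<Longrightarrow> v + w \<in> U"
    using F.open_add_halves[OF U] by metis
  obtain U2 where U2: "openin F U2" "0 \<in> U2" "\<And>v w. v \<in> U2 \<Longrightarrow> w \<in> U2 \<Longrightarrow> v + w \<in> U1"
    using F.open_add_halves[OF U1(1,2)] by metis
  obtain W1 where W1: "openin F W1" "x \<in> W1" "\<forall>h\<in>range T. \<forall>z\<in>W1. h z - h x \<in> U2"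
    using T x U2(1,2) unfolding equicontinuous_def by meson
  have "continuous_map F F (\<lambda>z. x - z)"
    using x by (intro F.continuous_map_diff) auto
  then have W2: "openin F {z \<in> topspace F. x - z \<in> U1}"
    using U1(1) by (rule openin_continuous_map_preimage)
  obtain W3 where W3: "openin F W3" "x \<in> W3" "\<And>z. z \<in> W3 \<Longrightarrow> z - x \<in> U2"
    using F.open_shift[OF U2(1,2) x] by metis
  have "\<forall>\<^sub>F k in sequentially. T k x \<in> W3"
    using lim[OF x] W3(1,2) by (simp add: limitin_def)
  then have "\<forall>\<^sub>F k in sequentially. \<forall>z\<in>W1 \<inter> {z \<in> topspace F. x - z \<in> U1}. T k z - z \<in> U"
  proof (rule eventually_mono, intro ballI)
    fix k z assume k: "T k x \<in> W3" and z: "z \<in> W1 \<inter> {z \<in> topspace F. x - z \<in> U1}"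
    have "T k z - T k x \<in> U2"
      using W1(3) z by blast
    then have "(T k z - T k x) + (T k x - x) \<in> U1"
      using W3(3)[OF k] by (rule U2(3))
    then have "((T k z - T k x) + (T k x - x)) + (x - z) \<in> U"
      using z by (intro U1(3)) auto
    then show "T k z - z \<in> U"
      by simp
  qed
  moreover have "openin F (W1 \<inter> {z \<in> topspace F. x - z \<in> U1})"
    using W1(1) W2 by (rule openin_Int)
  moreover have "x \<in> W1 \<inter> {z \<in> topspace F. x - z \<in> U1}"
    using W1(2) x U1(2) by simp
  ultimately show "\<exists>W. openin F W \<and> x \<in> W \<and> (\<forall>\<^sub>F k in sequentially. \<forall>z\<in>W. T k z - z \<in> U)"
    by blast
qed

lemma limitin_eps_id:
  assumes T: "\<And>k. T k \<in> linear_maps sF F sF F" "equicontinuous F F (range T)"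
    and lim: "\<And>x. x \<in> topspace F \<Longrightarrow> limitin F (\<lambda>k. T k x) x sequentially"
    and u: "u \<in> eps_maps"
  shows "limitin (eps_product sF F sE E) (\<lambda>k. eps_id sF F (T k) u) u sequentially"
  unfolding eps_product_def
proof (rule limitin_uniform_convergence)
  fix H V assume "H \<in> {H. H \<subseteq> dual sF F \<and> equicontinuous F euclidean H}" and V: "openin E V" "0 \<in> V"
  then have H: "H \<subseteq> dual sF F" "equicontinuous F euclidean H"
    by auto
  \<comment> \<open>The order of choices matters: \<open>u\<close> and \<open>V\<close> determine
    \<open>K\<close> and \<open>e\<close>, then \<open>H\<close> and \<open>e\<close> determine
    \<open>U\<close>. The index \<open>k\<close> depends on \<open>K\<close> and \<open>U\<close>
    only, which makes the convergence uniform over \<open>y \<in> H\<close>.\<close>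
  obtain K e where K: "compactin F K" "e > 0"
    "\<forall>y\<in>dual sF F. (\<forall>x\<in>K. norm (y x) < e) \<longrightarrow> u y \<in> V"
    by (rule eps_maps_bound[OF u V])
  have K_sub: "K \<subseteq> topspace F"
    using K(1) by (rule compactin_subset_topspace)
  obtain U where U: "openin F U" "0 \<in> U" "\<forall>y\<in>H. \<forall>z\<in>U. norm (y z) < e"
    by (rule equicontinuous_bound[OF H K(2)])
  have "\<forall>\<^sub>F k in sequentially. \<forall>x\<in>K. T k x - x \<in> U"
    by (rule uniform_convergence_on_compact[OF T(2) lim K(1) U(1,2)])
  then show "\<forall>\<^sub>F k in sequentially. \<forall>y\<in>H. eps_id sF F (T k) u y - u y \<in> V"
  proof (rule eventually_mono, intro ballI)
    fix k y assume k: "\<forall>x\<in>K. T k x - x \<in> U" and y: "y \<in> H"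
    have yD: "y \<in> dual sF F"
      using H(1) y by blast
    have diff: "(y \<circ> T k) - y \<in> dual sF F"
      using comp_in_dual[OF T(1) yD] yD by (rule dual.subspace_diff[OF subspace_dual])
    have "norm (((y \<circ> T k) - y) x) < e" if "x \<in> K" for x
    proof -
      have x: "x \<in> topspace F"
        using that K_sub by blast
      have "((y \<circ> T k) - y) x = y (T k x - x)"
        using linear_maps_diff[OF yD[unfolded dual_def] linear_maps_in[OF T(1) x] x]
          linear_maps_in[OF T(1) x] x by simp
      then show ?thesis
        using U(3) k y that by simp
    qed
    then have "u ((y \<circ> T k) - y) \<in> V"
      by (intro K(3)[rule_format] diff)
    then show "eps_id sF F (T k) u y - u y \<in> V"
      using linear_maps_diff[OF u, of "y \<circ> T k" y] comp_in_dual[OF T(1) yD] yD diff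
      by (simp add: eps_id_def transposed_def)
  qed
qed (use u eps_id_in_eps_maps T(1) in auto)

end

section \<open>Expansion operators of the basis, biorthogonality and the three claims\<close>

theorem theorem5p6p1:
  fixes sF :: "'k::real_or_complex \<Rightarrow> 'f::ab_group_add \<Rightarrow> 'f" and F :: "'f topology"
    and sE :: "'k \<Rightarrow> 'e::ab_group_add \<Rightarrow> 'e" and E :: "'e topology"
    and f :: "nat \<Rightarrow> 'f" and l :: "nat \<Rightarrow> 'f \<Rightarrow> 'k"
    and Q :: "nat \<Rightarrow> 'f \<Rightarrow> 'f"
    and P :: "nat \<Rightarrow> (('f \<Rightarrow> 'k) \<Rightarrow> 'e) \<Rightarrow> (('f \<Rightarrow> 'k) \<Rightarrow> 'e)"
  assumes "lcHs sF F" and "lcHs sE E"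
    and "equicontinuous_schauder_basis sF F f l"
    and "Q = (\<lambda>n x. sF (l n x) (f n))"
    and "P = (\<lambda>k. eps_id sF F (\<Sum>n\<le>k. Q n))"
  shows "schauder_decomposition (eps_scale sE) (eps_product sF F sE E) P \<and>
    (\<forall>u\<in>topspace (eps_product sF F sE E). \<forall>y\<in>dual sF F.
       limitin E (\<lambda>k. \<Sum>n\<le>k. sE (y (f n)) (u (l n))) (u y) sequentially) \<and>
    sequentially_dense (eps_product sF F sE E) (tensor_product sF F sE E)"
proof -
  interpret lcHs_pair sF F sE E
    using assms(1,2) by (simp add: lcHs_pair_def)
  have f: "f n \<in> topspace F" and l: "l n \<in> dual sF F" for n
    using assms(3) by (simp_all add: equicontinuous_schauder_basis_def schauder_basis_def)
  note l' = l[unfolded dual_def]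
  define T where "T k = (\<Sum>n\<le>k. Q n)" for k
  have T_apply: "T k x = (\<Sum>n\<le>k. sF (l n x) (f n))" for k x
    by (simp add: T_def assms(4) sum_fun_apply)
  have T: "T k \<in> linear_maps sF F sF F" for k
  proof -
    have "continuous_map F F (T k)"
      unfolding T_apply[abs_def] using f linear_maps_continuous[OF l']
      by (intro F.continuous_map_sum F.continuous_map_scale) auto
    then show ?thesis
      by (subst linear_maps_def) (simp add: continuous_linear_def T_apply linear_maps_add[OF l']
        linear_maps_scale[OF l'] linear_maps_outside[OF l'] F.scale_left_distrib sum.distrib F.scale_sum_right)
  qed
  have T_equicontinuous: "equicontinuous F F (range T)"
  proof -
    have "T = (\<lambda>k x. \<Sum>n\<le>k. sF (l n x) (f n))"
      by (intro ext) (rule T_apply)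
    then show ?thesis
      using assms(3) by (simp add: equicontinuous_schauder_basis_def)
  qed
  have T_lim: "limitin F (\<lambda>k. T k x) x sequentially" if "x \<in> topspace F" for x
    using assms(3) that by (simp add: equicontinuous_schauder_basis_def schauder_basis_def T_apply)
  \<comment> \<open>Biorthogonality: the Kronecker coefficients give an expansion of
    \<open>f m\<close> whose partial sums are constant from index \<open>m\<close> on, so uniqueness
    identifies them with \<open>l n (f m)\<close>.\<close>
  have l_f: "l n (f m) = (if n = m then 1 else 0)" for n m
  proof -
    let ?c = "\<lambda>n. if n = m then 1 else 0 :: 'k"
    have "\<forall>\<^sub>F k in sequentially. (\<Sum>n\<le>k. sF (?c n) (f n)) = f m"
      using eventually_ge_at_top[of m]
    proof eventually_elim
      case (elim k)
      have "(\<Sum>n\<le>k. sF (?c n) (f n)) = (\<Sum>n\<le>k. if n = m then f n else 0)"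
        by (intro sum.cong) auto
      then show ?case
        using elim by simp
    qed
    then have lim: "limitin F (\<lambda>k. \<Sum>n\<le>k. sF (?c n) (f n)) (f m) sequentially"
      using f by (intro limitin_eventually)
    have uniq: "\<forall>c. limitin F (\<lambda>k. \<Sum>n\<le>k. sF (c n) (f n)) (f m) sequentially \<longrightarrow> (\<forall>n. c n = l n (f m))"
      using assms(3) f by (simp add: equicontinuous_schauder_basis_def schauder_basis_def)
    have "\<forall>n. ?c n = l n (f m)"
      by (rule uniq[THEN spec, THEN mp, OF lim])
    then show ?thesis
      by simp
  qed
  have P: "P k = eps_id sF F (T k)" for k
    by (simp add: assms(5) T_def)
  have P_in: "P k u \<in> eps_maps" if "u \<in> eps_maps" for k u
    unfolding P using T that by (rule eps_id_in_eps_maps)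
  \<comment> \<open>Linearity of \<open>y\<close> expands \<open>y \<circ> T k\<close> in the
    \<open>l n\<close>, and linearity of \<open>u\<close> on the dual carries the sum into
    \<open>E\<close>. This formula yields the composition law, the distinctness of the
    \<open>P k\<close>, the series and the tensor form.\<close>
  have P_apply: "P k u y = (\<Sum>n\<le>k. sE (y (f n)) (u (l n)))"
    if u: "u \<in> eps_maps" and y: "y \<in> dual sF F" for k u y
  proof -
    note y' = y[unfolded dual_def]
    have "y \<circ> T k = (\<Sum>n\<le>k. (\<lambda>x. y (f n) * l n x))"
    proof
      fix x
      have "(y \<circ> T k) x = (\<Sum>n\<le>k. l n x * y (f n))"
        unfolding comp_apply T_apply
        using f by (intro linear_maps_sum[OF F.vector_space_axioms F.subspace_topspace y'])
      then show "(y \<circ> T k) x = (\<Sum>n\<le>k. (\<lambda>x. y (f n) * l n x)) x"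
        by (simp add: sum_fun_apply mult.commute)
    qed
    then have "P k u y = u (\<Sum>n\<le>k. (\<lambda>x. y (f n) * l n x))"
      using y by (simp add: P eps_id_def transposed_def)
    also have "\<dots> = (\<Sum>n\<le>k. sE (y (f n)) (u (l n)))"
      using subspace_dual l by (intro linear_maps_sum[OF dual.vector_space_axioms _ u]) auto
    finally show ?thesis .
  qed
  have P_zero: "P k u y = 0" if "u \<in> eps_maps" "y \<notin> dual sF F" for k u y
    using linear_maps_outside[OF P_in] that by simp
  have P_lim: "limitin (eps_product sF F sE E) (\<lambda>k. P k u) u sequentially" if "u \<in> eps_maps" for u
    unfolding P using T T_equicontinuous T_lim that by (rule limitin_eps_id)
  have P_P: "P k (P j u) = P (min j k) u" if u: "u \<in> eps_maps" for k j u
  proof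
    fix y
    have "P k (P j u) y = P (min j k) u y" if y: "y \<in> dual sF F"
    proof -
      \<comment> \<open>By biorthogonality \<open>P j\<close> keeps the values at \<open>l n\<close>
        for \<open>n \<le> j\<close> and annihilates the others; applying \<open>P k\<close> then
        leaves the indices up to \<open>min j k\<close>.\<close>
      have "P j u (l n) = (if n \<le> j then u (l n) else 0)" for n
      proof -
        have "P j u (l n) = (\<Sum>m\<le>j. if m = n then u (l m) else 0)"
          unfolding P_apply[OF u l] by (intro sum.cong) (auto simp: l_f)
        then show ?thesis
          by simp
      qed
      then have "P k (P j u) y = (\<Sum>n\<le>k. if n \<le> j then sE (y (f n)) (u (l n)) else 0)"
        unfolding P_apply[OF P_in[OF u] y] by (intro sum.cong) auto
      also have "\<dots> = (\<Sum>n\<in>{..k} \<inter> {n. n \<le> j}. sE (y (f n)) (u (l n)))"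
        by (simp add: sum.inter_restrict)
      also have "{..k} \<inter> {n. n \<le> j} = {..min j k}"
        by auto
      finally show ?thesis
        by (simp add: P_apply[OF u y])
    qed
    then show "P k (P j u) y = P (min j k) u y"
      using P_zero P_in u by metis
  qed
  have P_neq: "\<exists>u\<in>eps_maps. P k u \<noteq> P j u" if "k < j" for k j
  proof -
    obtain e where e: "e \<in> topspace E" "e \<noteq> 0"
      using E.nontrivial E.zero_in by blast
    \<comment> \<open>The elementary tensor \<open>f j \<otimes> e\<close> separates the two
      operators: \<open>P i\<close> reproduces its value \<open>e\<close> at \<open>l j\<close> if
      \<open>j \<le> i\<close> and gives 0 there otherwise, while \<open>k < j\<close>.\<close>
    define u where "u = (\<lambda>y. if y \<in> dual sF F then \<Sum>n<Suc 0. sE (y (f j)) e else 0)"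
    have u: "u \<in> eps_maps"
      unfolding u_def using f e(1) by (intro tensor_in_eps_maps) simp
    have "u (l n) = (if n = j then e else 0)" for n
      using l by (simp add: u_def l_f)
    then have "P i u (l j) = (if j \<le> i then e else 0)" for i
      unfolding P_apply[OF u l] by (simp add: l_f if_distrib[of "\<lambda>c. sE c _"] cong: if_cong)
    then have "P k u (l j) \<noteq> P j u (l j)"
      using that e(2) by simp
    then show ?thesis
      using u by metis
  qed
  \<comment> \<open>Since \<open>l 0 (f 0) = 1\<close>, the dual is nonzero, which gives
    non-triviality of \<open>F \<epsilon> E\<close>.\<close>
  have "l 0 \<noteq> 0"
    using l_f[of 0 0] by auto
  then have "lcHs (eps_scale sE) (eps_product sF F sE E)"
    using l by (intro lcHs_eps_product) blast
  moreover have "continuous_linear (eps_scale sE) (eps_product sF F sE E) (eps_scale sE) (eps_product sF F sE E) (P k)" for k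
    unfolding P using T by (rule continuous_linear_eps_id)
  moreover have "\<exists>u\<in>eps_maps. P k u \<noteq> P j u" if "k \<noteq> j" for k j
    using that P_neq[of k j] P_neq[of j k] by (metis nat_neq_iff)
  ultimately have a: "schauder_decomposition (eps_scale sE) (eps_product sF F sE E) P"
    unfolding schauder_decomposition_def by (simp add: P_P P_lim)
  \<comment> \<open>Evaluation at \<open>y\<close> is continuous on \<open>F \<epsilon> E\<close>,
    so the series is the image of the convergence of \<open>P k u\<close> to
    \<open>u\<close>.\<close>
  have b: "limitin E (\<lambda>k. \<Sum>n\<le>k. sE (y (f n)) (u (l n))) (u y) sequentially"
    if "u \<in> eps_maps" "y \<in> dual sF F" for u y
    using continuous_map_limit[OF continuous_map_eps_evaluation[OF that(2)] P_lim[OF that(1)]]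
    by (simp add: o_def P_apply that)
  \<comment> \<open>The tensor has \<open>Suc k\<close> summands, as partial sums run over
    \<open>n \<le> k\<close> and tensors over \<open>n < N\<close>.\<close>
  have P_tensor: "P k u \<in> tensor_product sF F sE E" if u: "u \<in> eps_maps" for k u
  proof -
    have "P k u = (\<lambda>y. if y \<in> dual sF F then \<Sum>n<Suc k. sE (y (f n)) (u (l n)) else 0)"
      by (intro ext) (simp add: P_apply[OF u] P_zero[OF u] lessThan_Suc_atMost)
    moreover have "u (l n) \<in> topspace E" for n
      using linear_maps_in[OF u] l by simp
    ultimately show ?thesis
      using f unfolding tensor_product_def
      by (intro CollectI exI[of _ "Suc k"] exI[of _ f] exI[of _ "\<lambda>n. u (l n)"]) simp
  qed
  have "sequentially_dense (eps_product sF F sE E) (tensor_product sF F sE E)"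
    unfolding sequentially_dense_def
  proof (intro conjI ballI)
    show "tensor_product sF F sE E \<subseteq> topspace (eps_product sF F sE E)"
      using tensor_product_subset by simp
    fix u assume "u \<in> topspace (eps_product sF F sE E)"
    then show "\<exists>a. (\<forall>k. a k \<in> tensor_product sF F sE E) \<and>
        limitin (eps_product sF F sE E) a u sequentially"
      using P_tensor P_lim by (intro exI[of _ "\<lambda>k. P k u"]) simp
  qed
  then show ?thesis
    using a b by simp
qed

end
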